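(* Let $A$ be an F-algebra with $A^*=\mathfrak{M}$, and let $\mathfrak{e}$ be the identity of $\mathfrak{M}$. For a closed left ideal $J$ of $A$ write $\mathfrak{e}_J=\mathfrak{e}|_J$. (1) If $A$ is left amenable and if $J$ is a closed left ideal of $A$ such that $\mathfrak{e}_J\neq 0$, then $J$ is $\mathfrak{e}_J$-amenable. (2) If there is a closed left ideal $J$ of $A$ such that $\mathfrak{e}_J\ne 0$ and $J$ is $\mathfrak{e}_J$-amenable, then $A$ is left amenable.
   Context: An F-algebra is a Banach algebra $A$ that is the (unique) predual of a $W^*$-algebra $\mathfrak{M}$ (so $A^*=\mathfrak{M}$) such that the identity $\mathfrak{e}$ of $\mathfrak{M}$ is a multiplicative linear functional on $A$. For a Banach $A$-bimodule $X$, the dual $X^*$ is a Banach $A$-bimodule via $\langle x, f\cdot a\rangle=\langle a\cdot x,f\rangle$, $\langle x,a\cdot f\rangle=\langle x\cdot a,f\rangle$. A derivation $D:A\to X^*$ is a linear map with $D(ab)=a\cdot D(b)+D(a)\cdot b$; it is inner if $D(a)=a\cdot f_0-f_0\cdot a$ for some fixed $f_0\in X^*$. The F-algebra $A$ is left amenable if, for each Banach $A$-bimodule $X$ whose left module action is $a\cdot x=\langle a,\mathfrak{e}\rangle x$ ($a\in A,x\in X$), every continuous derivation from $A$ into $X^*$ is inner. For a Banach algebra $B$ and a multiplicative linear functional $\varphi$ on $B$, $B$ is $\varphi$-amenable if there is $m\in B^{**}$ such that $m(\varphi)=1$ and $b\cdot m=\varphi(b)m$ for all $b\in B$. Here $B^{**}$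 carries the left $B$-module action dual to the right action of $B$ on $B^*$ given by $\langle x,f\cdot b\rangle=\langle bx,f\rangle$, i.e. $\langle f,b\cdot m\rangle=\langle f\cdot b,m\rangle$ for $f\in B^*$. A closed left ideal $J$ of $A$ is regarded as a Banach algebra in its own right, on which $\mathfrak{e}_J$ is multiplicative. *)

theory Defs
  imports "HOL-Analysis.Analysis" "HOL-Algebra.Module"
begin

text \<open>
  Normed spaces, algebras and modules are carrier-based, as in \<open>HOL-Algebra\<close>, because closed
  ideals, iterated duals and arbitrary Banach bimodules all have to be treated as objects.
  A record of type \<open>'a normed\<close> also has the fields \<open>mult\<close> and \<open>one\<close>; as with \<^locale>\<open>abelian_group\<close>,
  these are irrelevant unless a predicate below mentions them: \<open>mult\<close> plays no role for normed
  spaces, and \<open>one\<close> plays no role for (possibly non-unital) Banach algebras.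
\<close>

record 'a normed = "(complex, 'a) module" +
  vnorm :: "'a \<Rightarrow> real"

record 'a star_normed = "'a normed" +
  star :: "'a \<Rightarrow> 'a"

definition complex_field :: "complex ring" where
  "complex_field = \<lparr>carrier = UNIV, mult = (*), one = 1, zero = 0, add = (+)\<rparr>"

locale cnormed_space = Module.module complex_field V
  for V :: "('a, 'z) normed_scheme" (structure) +
  assumes vnorm_nonneg: "x \<in> carrier V \<Longrightarrow> 0 \<le> vnorm V x"
    and vnorm_eq_0_iff: "x \<in> carrier V \<Longrightarrow> vnorm V x = 0 \<longleftrightarrow> x = \<zero>"
    and vnorm_triangle:
      "\<lbrakk>x \<in> carrier V; y \<in> carrier V\<rbrakk> \<Longrightarrow> vnorm V (x \<oplus> y) \<le> vnorm V x + vnorm V y"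
    and vnorm_smult: "x \<in> carrier V \<Longrightarrow> vnorm V (c \<odot> x) = cmod c * vnorm V x"

text \<open>
  \<^locale>\<open>Metric_space\<close> requires nonnegativity and symmetry on the whole type, so the distance is
  set to 0 outside the carrier.
\<close>

definition norm_metric :: "('a, 'z) normed_scheme \<Rightarrow> 'a metric" where
  "norm_metric V = metric (carrier V,
     \<lambda>x y. if x \<in> carrier V \<and> y \<in> carrier V then vnorm V (x \<ominus>\<^bsub>V\<^esub> y) else 0)"

locale cbanach_space = cnormed_space V for V :: "('a, 'z) normed_scheme" (structure) +
  assumes complete: "mcomplete_of (norm_metric V)"

locale banach_algebra = cbanach_space A for A :: "('a, 'z) normed_scheme" (structure) +
  assumes mult_closed: "\<lbrakk>a \<in> carrier A; b \<in> carrier A\<rbrakk> \<Longrightarrow> a \<otimes> b \<in> carrier A"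
    and mult_assoc: "\<lbrakk>a \<in> carrier A; b \<in> carrier A; c \<in> carrier A\<rbrakk> \<Longrightarrow>
      (a \<otimes> b) \<otimes> c = a \<otimes> (b \<otimes> c)"
    and mult_l_distr: "\<lbrakk>a \<in> carrier A; b \<in> carrier A; c \<in> carrier A\<rbrakk> \<Longrightarrow>
      (a \<oplus> b) \<otimes> c = a \<otimes> c \<oplus> b \<otimes> c"
    and mult_r_distr: "\<lbrakk>a \<in> carrier A; b \<in> carrier A; c \<in> carrier A\<rbrakk> \<Longrightarrow>
      a \<otimes> (b \<oplus> c) = a \<otimes> b \<oplus> a \<otimes> c"
    and mult_smult_l: "\<lbrakk>a \<in> carrier A; b \<in> carrier A\<rbrakk> \<Longrightarrow> (z \<odot> a) \<otimes> b = z \<odot> (a \<otimes> b)"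
    and mult_smult_r: "\<lbrakk>a \<in> carrier A; b \<in> carrier A\<rbrakk> \<Longrightarrow> a \<otimes> (z \<odot> b) = z \<odot> (a \<otimes> b)"
    and vnorm_mult: "\<lbrakk>a \<in> carrier A; b \<in> carrier A\<rbrakk> \<Longrightarrow> vnorm A (a \<otimes> b) \<le> vnorm A a * vnorm A b"

locale unital_cstar_algebra = banach_algebra M + monoid M
  for M :: "('m, 'z) star_normed_scheme" (structure) +
  assumes star_closed: "x \<in> carrier M \<Longrightarrow> star M x \<in> carrier M"
    and star_star: "x \<in> carrier M \<Longrightarrow> star M (star M x) = x"
    and star_add: "\<lbrakk>x \<in> carrier M; y \<in> carrier M\<rbrakk> \<Longrightarrow> star M (x \<oplus> y) = star M x \<oplus> star M y"
    and star_smult: "x \<in> carrier M \<Longrightarrow> star M (z \<odot> x) = cnj z \<odot> star M x"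
    and star_mult: "\<lbrakk>x \<in> carrier M; y \<in> carrier M\<rbrakk> \<Longrightarrow> star M (x \<otimes> y) = star M y \<otimes> star M x"
    and cstar_identity: "x \<in> carrier M \<Longrightarrow> vnorm M (star M x \<otimes> x) = (vnorm M x)\<^sup>2"

definition bounded_functional :: "('a, 'z) normed_scheme \<Rightarrow> ('a \<Rightarrow> complex) \<Rightarrow> bool" where
  "bounded_functional V f \<longleftrightarrow>
     (\<forall>x\<in>carrier V. \<forall>y\<in>carrier V. f (x \<oplus>\<^bsub>V\<^esub> y) = f x + f y) \<and>
     (\<forall>c. \<forall>x\<in>carrier V. f (c \<odot>\<^bsub>V\<^esub> x) = c * f x) \<and>
     (\<exists>K. \<forall>x\<in>carrier V. cmod (f x) \<le> K * vnorm V x)"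

text \<open>
  Functionals are normalised to be \<^const>\<open>undefined\<close> off the carrier, so that equality in the dual
  is equality on the carrier and the restriction of \<open>f\<close> to \<open>J\<close> is \<open>restrict f J\<close>.
\<close>

definition dual :: "('a, 'z) normed_scheme \<Rightarrow> ('a \<Rightarrow> complex) normed" where
  "dual V = \<lparr>
     carrier = {f \<in> extensional (carrier V). bounded_functional V f},
     mult = undefined, one = undefined,
     zero = (\<lambda>x\<in>carrier V. 0),
     add = (\<lambda>f g. \<lambda>x\<in>carrier V. f x + g x),
     smult = (\<lambda>c f. \<lambda>x\<in>carrier V. c * f x),
     vnorm = (\<lambda>f. SUP x\<in>{x \<in> carrier V. vnorm V x \<le> 1}. cmod (f x))\<rparr>"

definition multiplicative_functional :: "('a, 'z) normed_scheme \<Rightarrow> ('a \<Rightarrow> complex) \<Rightarrow> bool" where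
  "multiplicative_functional B \<phi> \<longleftrightarrow> \<phi> \<in> carrier (dual B) \<and>
     (\<forall>a\<in>carrier B. \<forall>b\<in>carrier B. \<phi> (a \<otimes>\<^bsub>B\<^esub> b) = \<phi> a * \<phi> b)"

text \<open>
  \<open>M\<close> is a C*-algebra whose underlying normed space is the Banach space dual of \<open>A\<close>, i.e. a
  W*-algebra (in Sakai's sense) with predual \<open>A\<close>. Existence of the unit of a W*-algebra and
  uniqueness of its predual are theorems of Sakai; the field \<open>one\<close> of \<open>M\<close> names that unit.
\<close>

definition wstar_algebra_with_predual ::
    "('a \<Rightarrow> complex) star_normed \<Rightarrow> ('a, 'z) normed_scheme \<Rightarrow> bool" where
  "wstar_algebra_with_predual M A \<longleftrightarrow> cbanach_space A \<and> unital_cstar_algebra M \<and>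
     normed.truncate M = (dual A)\<lparr>mult := mult M, one := one M\<rparr>"

definition F_algebra ::
    "('a, 'z) normed_scheme \<Rightarrow> ('a \<Rightarrow> complex) star_normed \<Rightarrow> bool" where
  "F_algebra A M \<longleftrightarrow> banach_algebra A \<and> wstar_algebra_with_predual M A \<and>
     multiplicative_functional A \<one>\<^bsub>M\<^esub>"

locale banach_bimodule = A: banach_algebra A + X: cbanach_space X
  for A :: "('a, 'z) normed_scheme" and X :: "('x, 'w) normed_scheme"
    and lact :: "'a \<Rightarrow> 'x \<Rightarrow> 'x" and ract :: "'x \<Rightarrow> 'a \<Rightarrow> 'x" +
  assumes lact_closed: "\<lbrakk>a \<in> carrier A; x \<in> carrier X\<rbrakk> \<Longrightarrow> lact a x \<in> carrier X"
    and lact_add_l: "\<lbrakk>a \<in> carrier A; b \<in> carrier A; x \<in> carrier X\<rbrakk> \<Longrightarrow>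
      lact (a \<oplus>\<^bsub>A\<^esub> b) x = lact a x \<oplus>\<^bsub>X\<^esub> lact b x"
    and lact_add_r: "\<lbrakk>a \<in> carrier A; x \<in> carrier X; y \<in> carrier X\<rbrakk> \<Longrightarrow>
      lact a (x \<oplus>\<^bsub>X\<^esub> y) = lact a x \<oplus>\<^bsub>X\<^esub> lact a y"
    and lact_smult_l: "\<lbrakk>a \<in> carrier A; x \<in> carrier X\<rbrakk> \<Longrightarrow>
      lact (c \<odot>\<^bsub>A\<^esub> a) x = c \<odot>\<^bsub>X\<^esub> lact a x"
    and lact_smult_r: "\<lbrakk>a \<in> carrier A; x \<in> carrier X\<rbrakk> \<Longrightarrow>
      lact a (c \<odot>\<^bsub>X\<^esub> x) = c \<odot>\<^bsub>X\<^esub> lact a x"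
    and lact_mult: "\<lbrakk>a \<in> carrier A; b \<in> carrier A; x \<in> carrier X\<rbrakk> \<Longrightarrow>
      lact (a \<otimes>\<^bsub>A\<^esub> b) x = lact a (lact b x)"
    and ract_closed: "\<lbrakk>a \<in> carrier A; x \<in> carrier X\<rbrakk> \<Longrightarrow> ract x a \<in> carrier X"
    and ract_add_l: "\<lbrakk>a \<in> carrier A; x \<in> carrier X; y \<in> carrier X\<rbrakk> \<Longrightarrow>
      ract (x \<oplus>\<^bsub>X\<^esub> y) a = ract x a \<oplus>\<^bsub>X\<^esub> ract y a"
    and ract_add_r: "\<lbrakk>a \<in> carrier A; b \<in> carrier A; x \<in> carrier X\<rbrakk> \<Longrightarrow>
      ract x (a \<oplus>\<^bsub>A\<^esub> b) = ract x a \<oplus>\<^bsub>X\<^esub> ract x b"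
    and ract_smult_l: "\<lbrakk>a \<in> carrier A; x \<in> carrier X\<rbrakk> \<Longrightarrow>
      ract (c \<odot>\<^bsub>X\<^esub> x) a = c \<odot>\<^bsub>X\<^esub> ract x a"
    and ract_smult_r: "\<lbrakk>a \<in> carrier A; x \<in> carrier X\<rbrakk> \<Longrightarrow>
      ract x (c \<odot>\<^bsub>A\<^esub> a) = c \<odot>\<^bsub>X\<^esub> ract x a"
    and ract_mult: "\<lbrakk>a \<in> carrier A; b \<in> carrier A; x \<in> carrier X\<rbrakk> \<Longrightarrow>
      ract x (a \<otimes>\<^bsub>A\<^esub> b) = ract (ract x a) b"
    and lact_ract: "\<lbrakk>a \<in> carrier A; b \<in> carrier A; x \<in> carrier X\<rbrakk> \<Longrightarrow>
      ract (lact a x) b = lact a (ract x b)"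
    and lact_bounded: "\<exists>K. \<forall>a\<in>carrier A. \<forall>x\<in>carrier X.
      vnorm X (lact a x) \<le> K * vnorm A a * vnorm X x"
    and ract_bounded: "\<exists>K. \<forall>a\<in>carrier A. \<forall>x\<in>carrier X.
      vnorm X (ract x a) \<le> K * vnorm A a * vnorm X x"

text \<open>The dual actions \<open>\<langle>x, a \<cdot> f\<rangle> = \<langle>x \<cdot> a, f\<rangle>\<close> and \<open>\<langle>x, f \<cdot> a\<rangle> = \<langle>a \<cdot> x, f\<rangle>\<close>.\<close>

definition dual_lact ::
    "('x, 'w) normed_scheme \<Rightarrow> ('x \<Rightarrow> 'a \<Rightarrow> 'x) \<Rightarrow> 'a \<Rightarrow> ('x \<Rightarrow> complex) \<Rightarrow> 'x \<Rightarrow> complex" where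
  "dual_lact X ract a f = (\<lambda>x\<in>carrier X. f (ract x a))"

definition dual_ract ::
    "('x, 'w) normed_scheme \<Rightarrow> ('a \<Rightarrow> 'x \<Rightarrow> 'x) \<Rightarrow> ('x \<Rightarrow> complex) \<Rightarrow> 'a \<Rightarrow> 'x \<Rightarrow> complex" where
  "dual_ract X lact f a = (\<lambda>x\<in>carrier X. f (lact a x))"

definition continuous_derivation ::
    "('a, 'z) normed_scheme \<Rightarrow> ('x, 'w) normed_scheme \<Rightarrow> ('a \<Rightarrow> 'x \<Rightarrow> 'x) \<Rightarrow> ('x \<Rightarrow> 'a \<Rightarrow> 'x) \<Rightarrow>
     ('a \<Rightarrow> 'x \<Rightarrow> complex) \<Rightarrow> bool" where
  "continuous_derivation A X lact ract D \<longleftrightarrow>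
     D \<in> carrier A \<rightarrow> carrier (dual X) \<and>
     (\<forall>a\<in>carrier A. \<forall>b\<in>carrier A. D (a \<oplus>\<^bsub>A\<^esub> b) = D a \<oplus>\<^bsub>dual X\<^esub> D b) \<and>
     (\<forall>c. \<forall>a\<in>carrier A. D (c \<odot>\<^bsub>A\<^esub> a) = c \<odot>\<^bsub>dual X\<^esub> D a) \<and>
     (\<forall>a\<in>carrier A. \<forall>b\<in>carrier A.
        D (a \<otimes>\<^bsub>A\<^esub> b) = dual_lact X ract a (D b) \<oplus>\<^bsub>dual X\<^esub> dual_ract X lact (D a) b) \<and>
     continuous_map (mtopology_of (norm_metric A)) (mtopology_of (norm_metric (dual X))) D"

definition inner_derivation ::
    "('a, 'z) normed_scheme \<Rightarrow> ('x, 'w) normed_scheme \<Rightarrow> ('a \<Rightarrow> 'x \<Rightarrow> 'x) \<Rightarrow> ('x \<Rightarrow> 'a \<Rightarrow> 'x) \<Rightarrow>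
     ('a \<Rightarrow> 'x \<Rightarrow> complex) \<Rightarrow> bool" where
  "inner_derivation A X lact ract D \<longleftrightarrow>
     (\<exists>f0\<in>carrier (dual X). \<forall>a\<in>carrier A.
        D a = dual_lact X ract a f0 \<ominus>\<^bsub>dual X\<^esub> dual_ract X lact f0 a)"

text \<open>
  HOL cannot quantify over all types inside a formula. The first argument is the type from which
  the elements of the bimodules are drawn: \<open>X\<close> ranges over all Banach bimodules whose carrier is
  any subset of \<open>'x\<close>, with arbitrary operations and norm. Left amenability in the usual sense is
  this property for every \<open>'x\<close>; hence it is a conclusion when \<open>'x\<close> is an arbitrary type variable,
  and it implies the property at any single type. Every module of cardinality at most that of
  \<open>'x\<close> is covered up to isomorphism.
\<close>

definition left_amenable ::
    "'x itself \<Rightarrow> ('a, 'z) normed_scheme \<Rightarrow> ('a \<Rightarrow> complex) star_normed \<Rightarrow> bool" where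
  "left_amenable _ A M \<longleftrightarrow>
     (\<forall>(X :: 'x normed) lact ract. banach_bimodule A X lact ract \<and>
        (\<forall>a\<in>carrier A. \<forall>x\<in>carrier X. lact a x = \<one>\<^bsub>M\<^esub> a \<odot>\<^bsub>X\<^esub> x) \<longrightarrow>
        (\<forall>D. continuous_derivation A X lact ract D \<longrightarrow> inner_derivation A X lact ract D))"

definition closed_left_ideal :: "'a set \<Rightarrow> ('a, 'z) normed_scheme \<Rightarrow> bool" where
  "closed_left_ideal J A \<longleftrightarrow> submodule J complex_field A \<and>
     (\<forall>a\<in>carrier A. \<forall>j\<in>J. a \<otimes>\<^bsub>A\<^esub> j \<in> J) \<and>
     closedin (mtopology_of (norm_metric A)) J"

text \<open>\<open>B\<close> is \<open>\<phi>\<close>-amenable; used only for \<open>\<phi>\<close> a multiplicative functional on the Banach algebra \<open>B\<close>.\<close>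

definition character_amenable :: "('a, 'z) normed_scheme \<Rightarrow> ('a \<Rightarrow> complex) \<Rightarrow> bool" where
  "character_amenable B \<phi> \<longleftrightarrow>
     (\<exists>m\<in>carrier (dual (dual B)). m \<phi> = 1 \<and>
        (\<forall>b\<in>carrier B.
           dual_lact (dual B) (dual_ract B (mult B)) b m = \<phi> b \<odot>\<^bsub>dual (dual B)\<^esub> m))"

end

theory Submission
  imports Defs
begin

text \<open>
  Write \<open>\<phi>\<close> for the identity of \<open>M\<close>, a multiplicative functional on \<open>A\<close>. Both halves turn on
  invariant functionals: \<open>m\<close> in a bidual with \<open>m \<phi> = 1\<close> and \<open>m (x \<mapsto> f (a x)) = \<phi> a * m f\<close>. Every
  left ideal \<open>J\<close> on which \<open>\<phi>\<close> is nonzero contains some \<open>u\<close> with \<open>\<phi> u = 1\<close>, and this \<open>u\<close> is what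
  carries information between \<open>J\<close> and \<open>A\<close>.

  From left amenability of \<open>A\<close> to amenability of \<open>J\<close>. The textbook module is the quotient of the
  dual \<open>A*\<close> by the line spanned by \<open>\<phi>\<close>, a submodule because \<open>\<phi> (a x) = \<phi> a * \<phi> x\<close>. Since \<open>\<phi> u = 1\<close>,
  the hyperplane \<open>X\<close> of functionals vanishing at \<open>u\<close> is a complement of that line, so it
  represents the quotient inside \<open>A*\<close> itself; the right action is translation followed by the
  projection of \<open>A*\<close> onto \<open>X\<close> along \<open>\<phi>\<close> (\<open>twisted_bimodule\<close>). The derivation that \<open>a\<close> induces on
  evaluation at \<open>u\<close> is \<open>D a f = f (a u)\<close>. If it is implemented by \<open>\<psi>\<close>, then evaluation at
  \<open>u\<close> minus \<open>\<psi>\<close> composed with the projection is invariant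
  (\<open>left_amenable_imp_character_amenable\<close>). Finally \<open>f \<mapsto> (a \<mapsto> f (a u))\<close> sends functionals on
  \<open>J\<close> to functionals on \<open>A\<close>, commutes with left translation by \<open>J\<close> and fixes \<open>\<phi>\<close>, so that
  composing \<open>m\<close> with it gives an invariant functional for \<open>J\<close>
  (\<open>character_amenable_imp_ideal\<close>).

  From amenability of \<open>J\<close> to left amenability of \<open>A\<close>. An \<open>m\<close> invariant under \<open>J\<close> is invariant
  under all of \<open>A\<close>, because translating by \<open>u\<close> costs nothing and \<open>a u\<close> lies in \<open>J\<close>
  (\<open>ideal_invariance_extends\<close>). For a derivation \<open>D\<close> into the dual of a module with left action
  \<open>a x = \<phi> a x\<close>, the Leibniz rule reads \<open>D (a j) x = D j (x a) + \<phi> j * D a x\<close>. Applying \<open>m\<close> in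
  the variable \<open>j\<close>, the average \<open>G x = m (j \<mapsto> D j x)\<close> satisfies
  \<open>\<phi> a * G x = G (x a) + D a x\<close>, which says that \<open>- G\<close> implements \<open>D\<close>
  (\<open>character_amenable_ideal_imp_inner\<close>).
\<close>

section \<open>Complex normed spaces and their duals\<close>

lemma complex_field_simps [simp]:
  "carrier complex_field = UNIV" "mult complex_field = (*)" "one complex_field = 1"
  "zero complex_field = 0" "add complex_field = (+)"
  by (simp_all add: complex_field_def)

lemma cring_complex_field: "cring complex_field"
  by (intro cringI abelian_groupI comm_monoidI)
    (auto simp: algebra_simps intro: exI[of _ "- x" for x])

lemma a_inv_complex_field [simp]: "\<ominus>\<^bsub>complex_field\<^esub> c = - c"
proof -
  interpret cring complex_field by (rule cring_complex_field)
  show ?thesis by (rule minus_equality) auto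
qed

context cnormed_space
begin

lemma scalar_closed [simp]: "x \<in> carrier V \<Longrightarrow> c \<odot> x \<in> carrier V"
  by (rule smult_closed) auto

lemma minus_conv_smult: "x \<in> carrier V \<Longrightarrow> \<ominus> x = (-1) \<odot> x"
  using smult_l_minus[of 1 x] smult_one[of x] by simp

lemma vnorm_zero [simp]: "vnorm V \<zero> = 0"
  using vnorm_eq_0_iff by blast

lemma vnorm_minus_commute:
  assumes "x \<in> carrier V" "y \<in> carrier V"
  shows "vnorm V (x \<ominus> y) = vnorm V (y \<ominus> x)"
proof -
  have "\<ominus> (x \<ominus> y) = y \<ominus> x"
    using assms by (simp add: M.minus_eq M.minus_add M.a_comm)
  then have "y \<ominus> x = (-1) \<odot> (x \<ominus> y)"
    using minus_conv_smult[of "x \<ominus> y"] assms by simp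
  then show ?thesis
    using vnorm_smult[of "x \<ominus> y" "-1"] assms by simp
qed

lemma minus_add_cancel: "x \<in> carrier V \<Longrightarrow> y \<in> carrier V \<Longrightarrow> (x \<ominus> y) \<oplus> y = x"
  by (simp add: M.minus_eq M.a_assoc M.l_neg)

lemma minus_eq_zero_iff:
  "x \<in> carrier V \<Longrightarrow> y \<in> carrier V \<Longrightarrow> x \<ominus> y = \<zero> \<longleftrightarrow> x = y"
  using minus_add_cancel[of x y] by (auto simp: M.minus_eq M.r_neg)

text \<open>
  This gives access to \<^const>\<open>mspace\<close> and \<^const>\<open>mdist\<close> of the norm metric, which are
  unspecified unless the distance passed to the constructor is a metric.
\<close>

lemma Metric_space_norm:
  "Metric_space (carrier V)
     (\<lambda>x y. if x \<in> carrier V \<and> y \<in> carrier V then vnorm V (x \<ominus> y) else 0)"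
proof
  fix x y z
  assume xyz: "x \<in> carrier V" "y \<in> carrier V" "z \<in> carrier V"
  have "x \<ominus> z = (x \<ominus> y) \<oplus> (y \<ominus> z)"
    using xyz by (simp add: M.minus_eq M.a_assoc M.r_neg1)
  then show "(if x \<in> carrier V \<and> z \<in> carrier V then vnorm V (x \<ominus> z) else 0)
    \<le> (if x \<in> carrier V \<and> y \<in> carrier V then vnorm V (x \<ominus> y) else 0)
      + (if y \<in> carrier V \<and> z \<in> carrier V then vnorm V (y \<ominus> z) else 0)"
    using xyz vnorm_triangle[of "x \<ominus> y" "y \<ominus> z"] by simp
qed (auto simp: vnorm_nonneg vnorm_minus_commute vnorm_eq_0_iff minus_eq_zero_iff)

lemma mspace_norm_metric [simp]: "mspace (norm_metric V) = carrier V"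
  by (simp add: norm_metric_def Metric_space.mspace_metric[OF Metric_space_norm])

lemma mdist_norm_metric:
  "x \<in> carrier V \<Longrightarrow> y \<in> carrier V \<Longrightarrow> mdist (norm_metric V) x y = vnorm V (x \<ominus> y)"
  by (simp add: norm_metric_def Metric_space.mdist_metric[OF Metric_space_norm])

lemma functional_minus:
  assumes "bounded_functional V f" "x \<in> carrier V" "y \<in> carrier V"
  shows "f (x \<ominus> y) = f x - f y"
  using assms by (simp add: bounded_functional_def M.minus_eq minus_conv_smult)

lemma functional_zero: "bounded_functional V f \<Longrightarrow> f \<zero> = 0"
  using smult_l_null[of \<zero>] unfolding bounded_functional_def
  by (metis M.zero_closed complex_field_simps(4) mult_zero_left)

end

lemma dual_simps [simp]:
  "zero (dual V) = (\<lambda>x\<in>carrier V. 0)"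
  "add (dual V) f g = (\<lambda>x\<in>carrier V. f x + g x)"
  "smult (dual V) c f = (\<lambda>x\<in>carrier V. c * f x)"
  by (simp_all add: dual_def)

lemma dual_carrier_iff:
  "f \<in> carrier (dual V) \<longleftrightarrow> f \<in> extensional (carrier V) \<and> bounded_functional V f"
  by (simp add: dual_def)

lemma dualD:
  assumes "f \<in> carrier (dual V)"
  shows "\<And>x y. \<lbrakk>x \<in> carrier V; y \<in> carrier V\<rbrakk> \<Longrightarrow> f (x \<oplus>\<^bsub>V\<^esub> y) = f x + f y"
    and "\<And>c x. x \<in> carrier V \<Longrightarrow> f (c \<odot>\<^bsub>V\<^esub> x) = c * f x"
    and "f \<in> extensional (carrier V)"
  using assms by (auto simp: dual_def bounded_functional_def)

context cnormed_space
begin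

lemma dual_bdd_above:
  assumes "f \<in> carrier (dual V)"
  shows "bdd_above ((\<lambda>x. cmod (f x)) ` {x \<in> carrier V. vnorm V x \<le> 1})"
proof -
  obtain K where K: "\<forall>x\<in>carrier V. cmod (f x) \<le> K * vnorm V x"
    using assms by (auto simp: dual_def bounded_functional_def)
  have "cmod (f x) \<le> \<bar>K\<bar>" if x: "x \<in> carrier V" "vnorm V x \<le> 1" for x
  proof -
    have "cmod (f x) \<le> K * vnorm V x" using K x by blast
    also have "\<dots> \<le> \<bar>K\<bar> * vnorm V x" using vnorm_nonneg[OF x(1)] by (simp add: mult_right_mono)
    also have "\<dots> \<le> \<bar>K\<bar>" using x(2) by (simp add: mult_left_le)
    finally show ?thesis .
  qed
  then show ?thesis by (intro bdd_aboveI[of _ "\<bar>K\<bar>"]) auto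
qed

lemma dual_norm_eq: "vnorm (dual V) f = (SUP x\<in>{x \<in> carrier V. vnorm V x \<le> 1}. cmod (f x))"
  by (simp add: dual_def)

lemma dual_norm_nonneg:
  assumes "f \<in> carrier (dual V)"
  shows "0 \<le> vnorm (dual V) f"
  unfolding dual_norm_eq
  using cSUP_upper[OF _ dual_bdd_above[OF assms], of \<zero>] by (auto intro: order_trans[OF norm_ge_zero])

text \<open>
  The dual norm is a supremum over the unit ball; rescaling \<open>x\<close> to norm 1 turns it into a bound at
  every point. Together with \<open>dual_norm_le\<close> below, this replaces the supremum in all that follows.
\<close>

lemma dual_norm_bound:
  assumes f: "f \<in> carrier (dual V)" and x: "x \<in> carrier V"
  shows "cmod (f x) \<le> vnorm (dual V) f * vnorm V x"
proof (cases "vnorm V x = 0")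
  case True
  then have "x = \<zero>" using vnorm_eq_0_iff x by blast
  then show ?thesis
    using functional_zero f by (simp add: dual_carrier_iff)
next
  case False
  then have pos: "vnorm V x > 0" using vnorm_nonneg[OF x] by linarith
  define c where "c = complex_of_real (1 / vnorm V x)"
  have "vnorm V (c \<odot> x) = 1" using pos x by (simp add: c_def vnorm_smult norm_divide)
  then have "cmod (f (c \<odot> x)) \<le> vnorm (dual V) f"
    unfolding dual_norm_eq using x by (intro cSUP_upper dual_bdd_above f) auto
  then have "cmod (f x) / vnorm V x \<le> vnorm (dual V) f"
    using pos x by (simp add: c_def dualD(2)[OF f] norm_mult norm_divide)
  then show ?thesis using pos by (simp add: field_simps)
qed

lemma dual_norm_le:
  assumes "0 \<le> K" "\<And>x. x \<in> carrier V \<Longrightarrow> cmod (f x) \<le> K * vnorm V x"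
  shows "vnorm (dual V) f \<le> K"
  unfolding dual_norm_eq
proof (rule cSUP_least)
  fix x assume "x \<in> {x \<in> carrier V. vnorm V x \<le> 1}"
  then show "cmod (f x) \<le> K"
    using assms(2)[of x] mult_left_mono[of "vnorm V x" 1 K] assms(1) by auto
qed (auto intro: exI[of _ \<zero>])

lemma dualI:
  assumes "\<And>x y. \<lbrakk>x \<in> carrier V; y \<in> carrier V\<rbrakk> \<Longrightarrow> f (x \<oplus> y) = f x + f y"
    and "\<And>c x. x \<in> carrier V \<Longrightarrow> f (c \<odot> x) = c * f x"
    and "\<And>x. x \<in> carrier V \<Longrightarrow> cmod (f x) \<le> K * vnorm V x"
  shows "restrict f (carrier V) \<in> carrier (dual V)"
  using assms unfolding dual_carrier_iff bounded_functional_def by simp blast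

lemma dual_ext:
  assumes "f \<in> carrier (dual V)" "g \<in> carrier (dual V)" "\<And>x. x \<in> carrier V \<Longrightarrow> f x = g x"
  shows "f = g"
  using assms by (meson dualD(3) extensionalityI)

lemma dual_add_closed:
  assumes "f \<in> carrier (dual V)" "g \<in> carrier (dual V)"
  shows "(\<lambda>x\<in>carrier V. f x + g x) \<in> carrier (dual V)"
proof (rule dualI)
  fix x assume x: "x \<in> carrier V"
  have "cmod (f x + g x) \<le> cmod (f x) + cmod (g x)" by (rule norm_triangle_ineq)
  also have "\<dots> \<le> vnorm (dual V) f * vnorm V x + vnorm (dual V) g * vnorm V x"
    using dual_norm_bound assms x by (intro add_mono) auto
  finally show "cmod (f x + g x) \<le> (vnorm (dual V) f + vnorm (dual V) g) * vnorm V x"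
    by (simp add: algebra_simps)
qed (use assms in \<open>auto simp: dualD algebra_simps\<close>)

lemma dual_smult_closed:
  assumes "f \<in> carrier (dual V)"
  shows "(\<lambda>x\<in>carrier V. c * f x) \<in> carrier (dual V)"
proof (rule dualI)
  fix x assume x: "x \<in> carrier V"
  show "cmod (c * f x) \<le> (cmod c * vnorm (dual V) f) * vnorm V x"
    using dual_norm_bound[OF assms x] by (simp add: norm_mult mult.assoc mult_left_mono)
qed (use assms in \<open>auto simp: dualD algebra_simps\<close>)

lemma dual_zero_closed: "(\<lambda>x\<in>carrier V. 0) \<in> carrier (dual V)"
  by (rule dualI[where K = 0]) auto

lemma cnormed_space_dual: "cnormed_space (dual V)"
proof -
  have "abelian_group (dual V)"
  proof (rule abelian_groupI)
    fix f assume f: "f \<in> carrier (dual V)"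
    show "\<exists>g\<in>carrier (dual V). g \<oplus>\<^bsub>dual V\<^esub> f = \<zero>\<^bsub>dual V\<^esub>"
      by (rule bexI[OF _ dual_smult_closed[OF f, of "-1"]]) auto
  qed (auto simp: dual_add_closed dual_zero_closed algebra_simps fun_eq_iff
        dest!: dualD(3) simp: extensional_def)
  then have "Module.module complex_field (dual V)"
    by (rule moduleI[OF cring_complex_field])
      (auto simp: dual_smult_closed algebra_simps fun_eq_iff dest!: dualD(3) simp: extensional_def)
  then show ?thesis
  proof (rule cnormed_space.intro, unfold_locales)
    fix f assume f: "f \<in> carrier (dual V)"
    show "0 \<le> vnorm (dual V) f" by (rule dual_norm_nonneg[OF f])
    show "vnorm (dual V) f = 0 \<longleftrightarrow> f = \<zero>\<^bsub>dual V\<^esub>"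
    proof
      assume "vnorm (dual V) f = 0"
      then have "\<And>x. x \<in> carrier V \<Longrightarrow> f x = 0" using dual_norm_bound[OF f] by fastforce
      then show "f = \<zero>\<^bsub>dual V\<^esub>" using dual_ext[OF f dual_zero_closed] by simp
    next
      assume "f = \<zero>\<^bsub>dual V\<^esub>"
      then have "vnorm (dual V) f \<le> 0" by (intro dual_norm_le) auto
      then show "vnorm (dual V) f = 0" using dual_norm_nonneg[OF f] by linarith
    qed
    fix g assume g: "g \<in> carrier (dual V)"
    show "vnorm (dual V) (f \<oplus>\<^bsub>dual V\<^esub> g) \<le> vnorm (dual V) f + vnorm (dual V) g"
    proof (rule dual_norm_le)
      fix x assume x: "x \<in> carrier V"
      have "cmod (f x + g x) \<le> cmod (f x) + cmod (g x)" by (rule norm_triangle_ineq)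
      also have "\<dots> \<le> vnorm (dual V) f * vnorm V x + vnorm (dual V) g * vnorm V x"
        using dual_norm_bound f g x by (intro add_mono) auto
      finally show "cmod ((f \<oplus>\<^bsub>dual V\<^esub> g) x) \<le> (vnorm (dual V) f + vnorm (dual V) g) * vnorm V x"
        using x by (simp add: algebra_simps)
    qed (use dual_norm_nonneg f g in auto)
  next
    fix f c assume f: "f \<in> carrier (dual V)"
    have le: "vnorm (dual V) (\<lambda>x\<in>carrier V. c * f x) \<le> cmod c * vnorm (dual V) f"
      if f: "f \<in> carrier (dual V)" for f c
    proof (rule dual_norm_le)
      fix x assume x: "x \<in> carrier V"
      show "cmod ((\<lambda>x\<in>carrier V. c * f x) x) \<le> cmod c * vnorm (dual V) f * vnorm V x"
        using x dual_norm_bound[OF f x] by (simp add: norm_mult mult.assoc mult_left_mono)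
    qed (use dual_norm_nonneg f in auto)
    show "vnorm (dual V) (c \<odot>\<^bsub>dual V\<^esub> f) = cmod c * vnorm (dual V) f"
    proof (cases "c = 0")
      case True
      then show ?thesis
        using le[OF f, of 0] dual_norm_nonneg[OF dual_zero_closed] by (simp cong: restrict_cong)
    next
      case False
      have "f = (\<lambda>x\<in>carrier V. inverse c * (\<lambda>x\<in>carrier V. c * f x) x)"
        using False dualD(3)[OF f] by (auto simp: fun_eq_iff extensional_def)
      then have "vnorm (dual V) f
          \<le> cmod (inverse c) * vnorm (dual V) (\<lambda>x\<in>carrier V. c * f x)"
        using le[OF dual_smult_closed[OF f, of c], of "inverse c"] by metis
      then show ?thesis
        using le[OF f, of c] False by (simp add: norm_inverse norm_divide field_simps)
    qed
  qed
qed

lemma dual_minus: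
  assumes f: "f \<in> carrier (dual V)" and g: "g \<in> carrier (dual V)"
  shows "f \<ominus>\<^bsub>dual V\<^esub> g = (\<lambda>x\<in>carrier V. f x - g x)"
proof -
  interpret D: cnormed_space "dual V" by (rule cnormed_space_dual)
  show ?thesis
    using D.minus_conv_smult[OF g] by (auto simp: D.M.minus_eq fun_eq_iff)
qed

end

section \<open>Continuity of linear maps and completeness\<close>

lemma linear_minus:
  assumes V: "cnormed_space V" and W: "cnormed_space W"
    and T: "T \<in> carrier V \<rightarrow> carrier W"
    and add: "\<And>x y. \<lbrakk>x \<in> carrier V; y \<in> carrier V\<rbrakk> \<Longrightarrow> T (x \<oplus>\<^bsub>V\<^esub> y) = T x \<oplus>\<^bsub>W\<^esub> T y"
    and smult: "\<And>c x. x \<in> carrier V \<Longrightarrow> T (c \<odot>\<^bsub>V\<^esub> x) = c \<odot>\<^bsub>W\<^esub> T x"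
    and x: "x \<in> carrier V" and y: "y \<in> carrier V"
  shows "T (x \<ominus>\<^bsub>V\<^esub> y) = T x \<ominus>\<^bsub>W\<^esub> T y"
proof -
  interpret V: cnormed_space V by (rule V)
  interpret W: cnormed_space W by (rule W)
  have "T y \<in> carrier W" using T y by blast
  then show ?thesis
    using x y by (simp add: V.M.minus_eq W.M.minus_eq V.minus_conv_smult W.minus_conv_smult add smult)
qed

text \<open>
  Continuity of a derivation is topological, while its use is through a norm estimate. By
  linearity, continuity at 0 with \<open>\<epsilon> = 1\<close> already gives one after rescaling.
\<close>

lemma continuous_map_linear_iff_bounded:
  assumes V: "cnormed_space V" and W: "cnormed_space W"
    and T: "T \<in> carrier V \<rightarrow> carrier W"
    and add: "\<And>x y. \<lbrakk>x \<in> carrier V; y \<in> carrier V\<rbrakk> \<Longrightarrow> T (x \<oplus>\<^bsub>V\<^esub> y) = T x \<oplus>\<^bsub>W\<^esub> T y"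
    and smult: "\<And>c x. x \<in> carrier V \<Longrightarrow> T (c \<odot>\<^bsub>V\<^esub> x) = c \<odot>\<^bsub>W\<^esub> T x"
  shows "continuous_map (mtopology_of (norm_metric V)) (mtopology_of (norm_metric W)) T \<longleftrightarrow>
    (\<exists>K. \<forall>x\<in>carrier V. vnorm W (T x) \<le> K * vnorm V x)"
    (is "?cont \<longleftrightarrow> ?bdd")
proof -
  interpret V: cnormed_space V by (rule V)
  interpret W: cnormed_space W by (rule W)
  note minus = linear_minus[OF assms]
  have T': "T x \<in> carrier W" if "x \<in> carrier V" for x using T that by blast
  have cont_iff: "?cont \<longleftrightarrow> (\<forall>a\<in>carrier V. \<forall>\<epsilon>>0. \<exists>\<delta>>0. \<forall>x. x \<in> carrier V \<and> vnorm V (a \<ominus>\<^bsub>V\<^esub> x) < \<delta>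
      \<longrightarrow> vnorm W (T (a \<ominus>\<^bsub>V\<^esub> x)) < \<epsilon>)"
    unfolding mtopology_of_def
      Metric_space.metric_continuous_map[OF Metric_space_mspace_mdist Metric_space_mspace_mdist]
    using T' by (simp add: image_subset_iff V.mdist_norm_metric W.mdist_norm_metric minus cong: conj_cong)
  have T0: "T \<zero>\<^bsub>V\<^esub> = \<zero>\<^bsub>W\<^esub>"
    using minus[of "\<zero>\<^bsub>V\<^esub>" "\<zero>\<^bsub>V\<^esub>"] V.minus_eq_zero_iff[of "\<zero>\<^bsub>V\<^esub>" "\<zero>\<^bsub>V\<^esub>"]
      W.minus_eq_zero_iff[of "T \<zero>\<^bsub>V\<^esub>" "T \<zero>\<^bsub>V\<^esub>"] T'[of "\<zero>\<^bsub>V\<^esub>"] by simp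
  show ?thesis
  proof
    assume ?cont
    then obtain \<delta> where \<delta>: "\<delta> > 0" and
      "\<forall>x. x \<in> carrier V \<and> vnorm V (\<zero>\<^bsub>V\<^esub> \<ominus>\<^bsub>V\<^esub> x) < \<delta> \<longrightarrow> vnorm W (T (\<zero>\<^bsub>V\<^esub> \<ominus>\<^bsub>V\<^esub> x)) < 1"
      unfolding cont_iff by (metis V.M.zero_closed zero_less_one)
    then have small: "vnorm W (T x) < 1" if "x \<in> carrier V" "vnorm V x < \<delta>" for x
      using that by (metis V.M.a_inv_closed V.M.minus_eq V.M.minus_minus V.M.l_zero)
    have "vnorm W (T x) \<le> 2 / \<delta> * vnorm V x" if x: "x \<in> carrier V" for x
    proof (cases "vnorm V x = 0")
      case True
      then show ?thesis using x V.vnorm_eq_0_iff T0 by simp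
    next
      case False
      then have pos: "vnorm V x > 0" using V.vnorm_nonneg[OF x] by linarith
      define c where "c = complex_of_real (\<delta> / (2 * vnorm V x))"
      have c: "cmod c = \<delta> / (2 * vnorm V x)"
        using pos \<delta> by (simp add: c_def norm_divide norm_mult)
      have "vnorm W (T (c \<odot>\<^bsub>V\<^esub> x)) < 1"
        by (rule small) (use x pos \<delta> c in \<open>simp_all add: V.vnorm_smult\<close>)
      then show ?thesis
        using x pos \<delta> c by (simp add: smult W.vnorm_smult[OF T'] field_simps)
    qed
    then show ?bdd by blast
  next
    assume ?bdd
    then obtain K where K: "\<And>x. x \<in> carrier V \<Longrightarrow> vnorm W (T x) \<le> K * vnorm V x" by blast
    have K': "vnorm W (T x) \<le> (\<bar>K\<bar> + 1) * vnorm V x" if "x \<in> carrier V" for x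
      using K[OF that] V.vnorm_nonneg[OF that]
      by (meson abs_ge_self add_increasing2 mult_right_mono order_trans zero_le_one)
    show ?cont
      unfolding cont_iff
    proof (intro ballI allI impI)
      fix a \<epsilon> assume a: "a \<in> carrier V" and \<epsilon>: "(\<epsilon>::real) > 0"
      show "\<exists>\<delta>>0. \<forall>x. x \<in> carrier V \<and> vnorm V (a \<ominus>\<^bsub>V\<^esub> x) < \<delta> \<longrightarrow> vnorm W (T (a \<ominus>\<^bsub>V\<^esub> x)) < \<epsilon>"
      proof (intro exI[of _ "\<epsilon> / (\<bar>K\<bar> + 1)"] conjI allI impI)
        show "\<epsilon> / (\<bar>K\<bar> + 1) > 0" using \<epsilon> by simp
        fix x assume x: "x \<in> carrier V \<and> vnorm V (a \<ominus>\<^bsub>V\<^esub> x) < \<epsilon> / (\<bar>K\<bar> + 1)"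
        have "vnorm W (T (a \<ominus>\<^bsub>V\<^esub> x)) \<le> (\<bar>K\<bar> + 1) * vnorm V (a \<ominus>\<^bsub>V\<^esub> x)"
          using K'[of "a \<ominus>\<^bsub>V\<^esub> x"] a x by simp
        also have "\<dots> < \<epsilon>" using x by (simp add: field_simps)
        finally show "vnorm W (T (a \<ominus>\<^bsub>V\<^esub> x)) < \<epsilon>" .
      qed
    qed
  qed
qed

context cnormed_space
begin

lemma cnormed_space_subspace:
  assumes "submodule H complex_field V"
  shows "cnormed_space (V\<lparr>carrier := H\<rparr>)"
proof -
  have "H \<subseteq> carrier V" by (rule submoduleE(1)[OF assms])
  then show ?thesis
    by (intro cnormed_space.intro submodule.submodule_is_module[OF assms module_axioms])
      (unfold_locales, auto simp: subset_iff vnorm_nonneg vnorm_eq_0_iff vnorm_triangle vnorm_smult)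
qed

lemma subspace_minus:
  assumes H: "submodule H complex_field V" and "x \<in> H" "y \<in> H"
  shows "x \<ominus>\<^bsub>V\<lparr>carrier := H\<rparr>\<^esub> y = x \<ominus> y"
proof -
  interpret S: cnormed_space "V\<lparr>carrier := H\<rparr>" by (rule cnormed_space_subspace[OF H])
  have "H \<subseteq> carrier V" by (rule submoduleE(1)[OF H])
  then show ?thesis
    using assms S.minus_conv_smult[of y] minus_conv_smult[of y] by (auto simp: S.M.minus_eq M.minus_eq)
qed

lemma kernel_submodule:
  assumes "bounded_functional V \<phi>"
  shows "submodule {x \<in> carrier V. \<phi> x = 0} complex_field V"
  using assms functional_zero[OF assms]
  by (intro submoduleI) (auto simp: bounded_functional_def minus_conv_smult)

lemma eval_in_bidual:
  assumes "x \<in> carrier V"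
  shows "(\<lambda>f\<in>carrier (dual V). f x) \<in> carrier (dual (dual V))"
proof -
  interpret D: cnormed_space "dual V" by (rule cnormed_space_dual)
  show ?thesis
    using assms dual_norm_bound
    by (intro D.dualI[where K = "vnorm V x"]) (auto simp: mult.commute)
qed

end

text \<open>
  A Cauchy sequence in the kernel converges in \<open>V\<close>, and the limit stays in the kernel because
  \<open>\<phi>\<close> is bounded.
\<close>

lemma (in cbanach_space) cbanach_space_kernel:
  assumes \<phi>: "\<phi> \<in> carrier (dual V)"
  shows "cbanach_space (V\<lparr>carrier := {x \<in> carrier V. \<phi> x = 0}\<rparr>)"
proof -
  define H where "H = {x \<in> carrier V. \<phi> x = 0}"
  have bf: "bounded_functional V \<phi>" using \<phi> by (simp add: dual_carrier_iff)
  have H: "submodule H complex_field V" unfolding H_def by (rule kernel_submodule[OF bf])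
  interpret S: cnormed_space "V\<lparr>carrier := H\<rparr>" by (rule cnormed_space_subspace[OF H])
  have HV: "x \<in> carrier V" if "x \<in> H" for x using that by (simp add: H_def)
  let ?S = "norm_metric (V\<lparr>carrier := H\<rparr>)"
  have dist: "mdist ?S x y = vnorm V (x \<ominus> y)" if "x \<in> H" "y \<in> H" for x y
    using that S.mdist_norm_metric by (simp add: subspace_minus[OF H])
  have "mcomplete_of ?S"
    unfolding mcomplete_of_def Metric_space.mcomplete_def[OF Metric_space_mspace_mdist]
  proof (intro allI impI)
    fix \<sigma> assume "Metric_space.MCauchy (mspace ?S) (mdist ?S) \<sigma>"
    then have \<sigma>: "\<And>n. \<sigma> n \<in> H"
      and Cauchy: "\<forall>\<epsilon>>0. \<exists>N. \<forall>n n'. N \<le> n \<longrightarrow> N \<le> n' \<longrightarrow> vnorm V (\<sigma> n \<ominus> \<sigma> n') < \<epsilon>"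
      unfolding Metric_space.MCauchy_def[OF Metric_space_mspace_mdist]
      by (auto simp: dist image_subset_iff)
    have "Metric_space.MCauchy (mspace (norm_metric V)) (mdist (norm_metric V)) \<sigma>"
      unfolding Metric_space.MCauchy_def[OF Metric_space_mspace_mdist]
      using Cauchy \<sigma> HV by (auto simp: mdist_norm_metric)
    then obtain l where "limitin (Metric_space.mtopology (mspace (norm_metric V)) (mdist (norm_metric V))) \<sigma> l sequentially"
      using complete unfolding mcomplete_of_def Metric_space.mcomplete_def[OF Metric_space_mspace_mdist]
      by blast
    then have l: "l \<in> carrier V" and lim: "\<forall>\<epsilon>>0. \<exists>N. \<forall>n\<ge>N. vnorm V (\<sigma> n \<ominus> l) < \<epsilon>"
      unfolding Metric_space.limit_metric_sequentially[OF Metric_space_mspace_mdist]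
      using \<sigma> HV by (auto simp: mdist_norm_metric)
    have "\<phi> l = 0"
    proof (rule ccontr)
      assume ne: "\<phi> l \<noteq> 0"
      \<comment> \<open>Adding 1 makes the bound on \<open>\<phi>\<close> positive, so that it can be divided by.\<close>
      define C where "C = vnorm (dual V) \<phi> + 1"
      have C: "C > 0" using dual_norm_nonneg[OF \<phi>] by (simp add: C_def)
      obtain n where n: "vnorm V (\<sigma> n \<ominus> l) < cmod (\<phi> l) / C"
        using lim ne C by (meson divide_pos_pos order_refl zero_less_norm_iff)
      have "cmod (\<phi> l) = cmod (\<phi> (\<sigma> n \<ominus> l))"
        using functional_minus[OF bf HV[OF \<sigma>] l] \<sigma>[of n] by (simp add: H_def)
      also have "\<dots> \<le> vnorm (dual V) \<phi> * vnorm V (\<sigma> n \<ominus> l)"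
        using dual_norm_bound[OF \<phi>] HV[OF \<sigma>] l by simp
      also have "\<dots> \<le> C * vnorm V (\<sigma> n \<ominus> l)"
        using vnorm_nonneg[of "\<sigma> n \<ominus> l"] HV[OF \<sigma>] l by (intro mult_right_mono) (auto simp: C_def)
      also have "\<dots> < cmod (\<phi> l)" using n C by (simp add: field_simps)
      finally show False by simp
    qed
    then have "l \<in> H" using l by (simp add: H_def)
    then show "\<exists>x. limitin (Metric_space.mtopology (mspace ?S) (mdist ?S)) \<sigma> x sequentially"
      unfolding Metric_space.limit_metric_sequentially[OF Metric_space_mspace_mdist]
      using \<sigma> lim by (intro exI[of _ l]) (simp add: dist)
  qed
  then show ?thesis
    unfolding H_def[symmetric] by (intro cbanach_space.intro S.cnormed_space_axioms) unfold_locales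
qed

text \<open>
  Completeness of the dual of \<open>A\<close> is inherited from \<open>M\<close>: the two have the same underlying normed
  space, hence the same norm metric.
\<close>

lemma wstar_predual_dual_banach:
  assumes "wstar_algebra_with_predual M A"
  shows "cbanach_space (dual A)"
proof -
  interpret M: unital_cstar_algebra M
    using assms by (simp add: wstar_algebra_with_predual_def)
  interpret A: cbanach_space A
    using assms by (simp add: wstar_algebra_with_predual_def)
  have eq: "normed.truncate M = (dual A)\<lparr>mult := mult M, one := one M\<rparr>"
    using assms by (simp add: wstar_algebra_with_predual_def)
  have [simp]: "carrier M = carrier (dual A)" "zero M = zero (dual A)" "add M = add (dual A)"
    "vnorm M = vnorm (dual A)"
    using arg_cong[OF eq, of carrier] arg_cong[OF eq, of zero] arg_cong[OF eq, of add]
      arg_cong[OF eq, of vnorm] by (simp_all add: normed.defs)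
  have "norm_metric M = norm_metric (dual A)"
    by (simp add: norm_metric_def a_minus_def a_inv_def m_inv_def cong: if_cong)
  then show ?thesis
    using M.complete by (intro cbanach_space.intro A.cnormed_space_dual) (unfold_locales, simp)
qed

section \<open>Invariant functionals and derivations, pointwise\<close>

lemma character_amenable_iff:
  "character_amenable B \<phi> \<longleftrightarrow>
    (\<exists>m\<in>carrier (dual (dual B)). m \<phi> = 1 \<and>
      (\<forall>b\<in>carrier B. \<forall>f\<in>carrier (dual B). m (\<lambda>x\<in>carrier B. f (b \<otimes>\<^bsub>B\<^esub> x)) = \<phi> b * m f))"
  by (auto simp: character_amenable_def dual_lact_def dual_ract_def restrict_def fun_eq_iff)

context banach_bimodule
begin

lemma dual_lact_closed:
  assumes f: "f \<in> carrier (dual X)" and a: "a \<in> carrier A"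
  shows "dual_lact X ract a f \<in> carrier (dual X)"
proof -
  obtain K where K: "\<forall>a\<in>carrier A. \<forall>x\<in>carrier X. vnorm X (ract x a) \<le> K * vnorm A a * vnorm X x"
    using ract_bounded by blast
  have "cmod (f (ract x a)) \<le> (vnorm (dual X) f * (K * vnorm A a)) * vnorm X x"
    if x: "x \<in> carrier X" for x
  proof -
    have "cmod (f (ract x a)) \<le> vnorm (dual X) f * vnorm X (ract x a)"
      by (intro X.dual_norm_bound f ract_closed a x)
    also have "\<dots> \<le> vnorm (dual X) f * (K * vnorm A a * vnorm X x)"
      using K a x by (intro mult_left_mono X.dual_norm_nonneg f) blast
    finally show ?thesis by (simp add: mult_ac)
  qed
  then show ?thesis
    unfolding dual_lact_def
    by (intro X.dualI) (use a in \<open>auto simp: ract_add_l ract_smult_l ract_closed dualD[OF f]\<close>)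
qed

lemma dual_ract_closed:
  assumes f: "f \<in> carrier (dual X)" and a: "a \<in> carrier A"
  shows "dual_ract X lact f a \<in> carrier (dual X)"
proof -
  obtain K where K: "\<forall>a\<in>carrier A. \<forall>x\<in>carrier X. vnorm X (lact a x) \<le> K * vnorm A a * vnorm X x"
    using lact_bounded by blast
  have "cmod (f (lact a x)) \<le> (vnorm (dual X) f * (K * vnorm A a)) * vnorm X x"
    if x: "x \<in> carrier X" for x
  proof -
    have "cmod (f (lact a x)) \<le> vnorm (dual X) f * vnorm X (lact a x)"
      by (intro X.dual_norm_bound f lact_closed a x)
    also have "\<dots> \<le> vnorm (dual X) f * (K * vnorm A a * vnorm X x)"
      using K a x by (intro mult_left_mono X.dual_norm_nonneg f) blast
    finally show ?thesis by (simp add: mult_ac)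
  qed
  then show ?thesis
    unfolding dual_ract_def
    by (intro X.dualI) (use a in \<open>auto simp: lact_add_r lact_smult_r lact_closed dualD[OF f]\<close>)
qed

text \<open>
  Closedness of the dual actions is what makes the subtraction in \<^const>\<open>inner_derivation\<close>, a group
  operation of the dual space, agree with pointwise subtraction.
\<close>

lemma inner_derivation_iff:
  assumes D: "D \<in> carrier A \<rightarrow> carrier (dual X)"
  shows "inner_derivation A X lact ract D \<longleftrightarrow>
    (\<exists>f\<in>carrier (dual X). \<forall>a\<in>carrier A. \<forall>x\<in>carrier X. D a x = f (ract x a) - f (lact a x))"
proof -
  have "D a = dual_lact X ract a f \<ominus>\<^bsub>dual X\<^esub> dual_ract X lact f a \<longleftrightarrow>
      (\<forall>x\<in>carrier X. D a x = f (ract x a) - f (lact a x))"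
    if a: "a \<in> carrier A" and f: "f \<in> carrier (dual X)" for a f
  proof -
    have "D a \<in> extensional (carrier X)" using D a dualD(3) by blast
    then show ?thesis
      unfolding X.dual_minus[OF dual_lact_closed[OF f a] dual_ract_closed[OF f a]]
      by (auto simp: fun_eq_iff dual_lact_def dual_ract_def extensional_def)
  qed
  then show ?thesis unfolding inner_derivation_def by (simp cong: ball_cong bex_cong)
qed

end

section \<open>Left amenability yields an invariant functional\<close>

locale character_algebra = banach_algebra A for A :: "('a, 'z) normed_scheme" (structure) +
  fixes \<phi> :: "'a \<Rightarrow> complex"
  assumes character: "multiplicative_functional A \<phi>"
begin

lemma \<phi>_dual: "\<phi> \<in> carrier (dual A)"
  using character by (simp add: multiplicative_functional_def)

lemma \<phi>_mult: "a \<in> carrier A \<Longrightarrow> b \<in> carrier A \<Longrightarrow> \<phi> (a \<otimes> b) = \<phi> a * \<phi> b"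
  using character by (simp add: multiplicative_functional_def)

lemmas \<phi>_add = dualD(1)[OF \<phi>_dual] and \<phi>_smult = dualD(2)[OF \<phi>_dual]

lemma translate_bound:
  assumes "f \<in> carrier (dual A)" "a \<in> carrier A" "x \<in> carrier A"
  shows "cmod (f (a \<otimes> x)) \<le> vnorm (dual A) f * vnorm A a * vnorm A x"
proof -
  have "cmod (f (a \<otimes> x)) \<le> vnorm (dual A) f * vnorm A (a \<otimes> x)"
    using assms by (intro dual_norm_bound mult_closed)
  also have "\<dots> \<le> vnorm (dual A) f * (vnorm A a * vnorm A x)"
    using assms by (intro mult_left_mono vnorm_mult dual_norm_nonneg)
  finally show ?thesis by (simp add: mult.assoc)
qed

lemma left_translate_closed:
  assumes "f \<in> carrier (dual A)" "a \<in> carrier A"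
  shows "(\<lambda>x\<in>carrier A. f (a \<otimes> x)) \<in> carrier (dual A)"
  by (rule dualI[where K = "vnorm (dual A) f * vnorm A a"])
    (use assms translate_bound[OF assms] in \<open>auto simp: mult_r_distr mult_smult_r mult_closed dualD\<close>)

lemma left_translate_norm:
  assumes "f \<in> carrier (dual A)" "a \<in> carrier A"
  shows "vnorm (dual A) (\<lambda>x\<in>carrier A. f (a \<otimes> x)) \<le> vnorm (dual A) f * vnorm A a"
  using assms translate_bound[OF assms]
  by (intro dual_norm_le mult_nonneg_nonneg dual_norm_nonneg vnorm_nonneg) auto

text \<open>
  When \<open>\<phi> u = 1\<close> this is the projection of the dual along \<open>\<phi>\<close> onto the functionals that vanish
  at \<open>u\<close>.
\<close>

definition annihilator_proj :: "'a \<Rightarrow> ('a \<Rightarrow> complex) \<Rightarrow> 'a \<Rightarrow> complex" where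
  "annihilator_proj u f = (\<lambda>x\<in>carrier A. f x - f u * \<phi> x)"

lemma annihilator_proj_bound:
  assumes u: "u \<in> carrier A" and f: "f \<in> carrier (dual A)" and x: "x \<in> carrier A"
  shows "cmod (f x - f u * \<phi> x)
    \<le> (1 + vnorm A u * vnorm (dual A) \<phi>) * vnorm (dual A) f * vnorm A x"
proof -
  have "cmod (f x - f u * \<phi> x) \<le> cmod (f x) + cmod (f u) * cmod (\<phi> x)"
    by (metis norm_mult norm_triangle_ineq4)
  also have "\<dots> \<le> vnorm (dual A) f * vnorm A x
      + (vnorm (dual A) f * vnorm A u) * (vnorm (dual A) \<phi> * vnorm A x)"
    using assms
    by (intro add_mono mult_mono dual_norm_bound \<phi>_dual mult_nonneg_nonneg
        dual_norm_nonneg vnorm_nonneg norm_ge_zero)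
  finally show ?thesis by (simp add: algebra_simps)
qed

lemma annihilator_proj_closed:
  assumes "u \<in> carrier A" "f \<in> carrier (dual A)"
  shows "annihilator_proj u f \<in> carrier (dual A)"
  unfolding annihilator_proj_def
  by (rule dualI[OF _ _ annihilator_proj_bound[OF assms]])
    (use assms in \<open>auto simp: dualD \<phi>_add \<phi>_smult algebra_simps\<close>)

lemma annihilator_proj_norm:
  assumes "u \<in> carrier A" "f \<in> carrier (dual A)"
  shows "vnorm (dual A) (annihilator_proj u f)
    \<le> (1 + vnorm A u * vnorm (dual A) \<phi>) * vnorm (dual A) f"
  using assms annihilator_proj_bound[OF assms]
  by (intro dual_norm_le mult_nonneg_nonneg add_nonneg_nonneg dual_norm_nonneg vnorm_nonneg \<phi>_dual)
    (auto simp: annihilator_proj_def)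

text \<open>
  The right action on the quotient of the dual by the line of \<open>\<phi>\<close>, transported to the
  complement of functionals vanishing at \<open>u\<close>.
\<close>

definition twisted_translate :: "'a \<Rightarrow> ('a \<Rightarrow> complex) \<Rightarrow> 'a \<Rightarrow> 'a \<Rightarrow> complex" where
  "twisted_translate u f a = annihilator_proj u (\<lambda>x\<in>carrier A. f (a \<otimes> x))"

lemma twisted_translate_eq:
  "u \<in> carrier A \<Longrightarrow> twisted_translate u f a = (\<lambda>x\<in>carrier A. f (a \<otimes> x) - f (a \<otimes> u) * \<phi> x)"
  by (auto simp: twisted_translate_def annihilator_proj_def fun_eq_iff)

text \<open>
  Realising the quotient by the line of \<open>\<phi>\<close> as a hyperplane keeps its elements functionals on
  \<open>A\<close>, the type at which left amenability is assumed. The hyperplane is the kernel of evaluation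
  at \<open>u\<close>, hence complete. The projection need not be contractive, so the right action is bounded with
  a constant that depends on \<open>u\<close>. It is associative because \<open>\<phi>\<close> is multiplicative: the multiple of
  \<open>\<phi>\<close> removed by the first translation becomes another multiple of \<open>\<phi>\<close> under the second, and the
  projection kills it.
\<close>

lemma twisted_bimodule:
  assumes banach: "cbanach_space (dual A)" and u: "u \<in> carrier A" and \<phi>u: "\<phi> u = 1"
  defines "X \<equiv> (dual A)\<lparr>carrier := {f \<in> carrier (dual A). f u = 0}\<rparr>"
  shows "banach_bimodule A X (\<lambda>a f. \<phi> a \<odot>\<^bsub>X\<^esub> f) (twisted_translate u)"
proof -
  interpret D: cbanach_space "dual A" by (rule banach)
  have Xeq: "{f \<in> carrier (dual A). f u = 0} = {f \<in> carrier (dual A). (\<lambda>f\<in>carrier (dual A). f u) f = 0}"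
    by auto
  have X: "cbanach_space X"
    unfolding X_def Xeq by (rule D.cbanach_space_kernel[OF eval_in_bidual[OF u]])
  interpret X: cbanach_space X by (rule X)
  have car [simp]: "carrier X = {f \<in> carrier (dual A). f u = 0}"
    and ops [simp]: "f \<oplus>\<^bsub>X\<^esub> g = (\<lambda>x\<in>carrier A. f x + g x)" "c \<odot>\<^bsub>X\<^esub> f = (\<lambda>x\<in>carrier A. c * f x)"
      "vnorm X = vnorm (dual A)" for f g c
    by (simp_all add: X_def)
  have tt: "twisted_translate u f a \<in> carrier X" if "f \<in> carrier X" "a \<in> carrier A" for f a
    using that u \<phi>u annihilator_proj_closed[OF u left_translate_closed]
    by (simp add: twisted_translate_def annihilator_proj_def)
  have nX: "0 \<le> vnorm X f" if "f \<in> carrier X" for f using X.vnorm_nonneg[OF that] .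
  show ?thesis
  proof (intro banach_bimodule.intro banach_algebra_axioms X banach_bimodule_axioms.intro)
    fix a f assume "a \<in> carrier A" "f \<in> carrier X"
    then show "\<phi> a \<odot>\<^bsub>X\<^esub> f \<in> carrier X" by (intro X.scalar_closed)
  next
    fix a b f assume *: "a \<in> carrier A" "b \<in> carrier A" "f \<in> carrier X"
    then show "\<phi> (a \<oplus> b) \<odot>\<^bsub>X\<^esub> f = \<phi> a \<odot>\<^bsub>X\<^esub> f \<oplus>\<^bsub>X\<^esub> \<phi> b \<odot>\<^bsub>X\<^esub> f"
      by (simp add: \<phi>_add fun_eq_iff algebra_simps)
  next
    fix a f g assume *: "a \<in> carrier A" "f \<in> carrier X" "g \<in> carrier X"
    then show "\<phi> a \<odot>\<^bsub>X\<^esub> (f \<oplus>\<^bsub>X\<^esub> g) = \<phi> a \<odot>\<^bsub>X\<^esub> f \<oplus>\<^bsub>X\<^esub> \<phi> a \<odot>\<^bsub>X\<^esub> g"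
      by (simp add: fun_eq_iff algebra_simps)
  next
    fix a f c assume *: "a \<in> carrier A" "f \<in> carrier X"
    then show "\<phi> (c \<odot> a) \<odot>\<^bsub>X\<^esub> f = c \<odot>\<^bsub>X\<^esub> (\<phi> a \<odot>\<^bsub>X\<^esub> f)"
      by (simp add: \<phi>_smult fun_eq_iff algebra_simps)
  next
    fix a f c assume *: "a \<in> carrier A" "f \<in> carrier X"
    then show "\<phi> a \<odot>\<^bsub>X\<^esub> (c \<odot>\<^bsub>X\<^esub> f) = c \<odot>\<^bsub>X\<^esub> (\<phi> a \<odot>\<^bsub>X\<^esub> f)"
      by (simp add: fun_eq_iff algebra_simps)
  next
    fix a b f assume *: "a \<in> carrier A" "b \<in> carrier A" "f \<in> carrier X"
    then show "\<phi> (a \<otimes> b) \<odot>\<^bsub>X\<^esub> f = \<phi> a \<odot>\<^bsub>X\<^esub> (\<phi> b \<odot>\<^bsub>X\<^esub> f)"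
      by (simp add: \<phi>_mult fun_eq_iff algebra_simps)
  next
    fix a f assume "a \<in> carrier A" "f \<in> carrier X"
    then show "twisted_translate u f a \<in> carrier X" by (intro tt)
  next
    fix a f g assume *: "a \<in> carrier A" "f \<in> carrier X" "g \<in> carrier X"
    then show "twisted_translate u (f \<oplus>\<^bsub>X\<^esub> g) a = twisted_translate u f a \<oplus>\<^bsub>X\<^esub> twisted_translate u g a"
      using u by (simp add: twisted_translate_eq fun_eq_iff mult_closed algebra_simps)
  next
    fix a b f assume *: "a \<in> carrier A" "b \<in> carrier A" "f \<in> carrier X"
    then show "twisted_translate u f (a \<oplus> b) = twisted_translate u f a \<oplus>\<^bsub>X\<^esub> twisted_translate u f b"
      using u by (simp add: twisted_translate_eq fun_eq_iff mult_l_distr mult_closed dualD algebra_simps)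
  next
    fix a f c assume *: "a \<in> carrier A" "f \<in> carrier X"
    then show "twisted_translate u (c \<odot>\<^bsub>X\<^esub> f) a = c \<odot>\<^bsub>X\<^esub> twisted_translate u f a"
      using u by (simp add: twisted_translate_eq fun_eq_iff mult_closed algebra_simps)
  next
    fix a f c assume *: "a \<in> carrier A" "f \<in> carrier X"
    then show "twisted_translate u f (c \<odot> a) = c \<odot>\<^bsub>X\<^esub> twisted_translate u f a"
      using u by (simp add: twisted_translate_eq fun_eq_iff mult_smult_l mult_closed dualD algebra_simps)
  next
    fix a b f assume *: "a \<in> carrier A" "b \<in> carrier A" "f \<in> carrier X"
    then show "twisted_translate u f (a \<otimes> b) = twisted_translate u (twisted_translate u f a) b"
      using u \<phi>u by (simp add: twisted_translate_eq fun_eq_iff mult_assoc mult_closed \<phi>_mult algebra_simps)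
  next
    fix a b f assume *: "a \<in> carrier A" "b \<in> carrier A" "f \<in> carrier X"
    then show "twisted_translate u (\<phi> a \<odot>\<^bsub>X\<^esub> f) b = \<phi> a \<odot>\<^bsub>X\<^esub> twisted_translate u f b"
      using u by (simp add: twisted_translate_eq fun_eq_iff mult_closed algebra_simps)
  next
    show "\<exists>K. \<forall>a\<in>carrier A. \<forall>f\<in>carrier X. vnorm X (\<phi> a \<odot>\<^bsub>X\<^esub> f) \<le> K * vnorm A a * vnorm X f"
    proof (intro exI[of _ "vnorm (dual A) \<phi>"] ballI)
      fix a f assume a: "a \<in> carrier A" and f: "f \<in> carrier X"
      show "vnorm X (\<phi> a \<odot>\<^bsub>X\<^esub> f) \<le> vnorm (dual A) \<phi> * vnorm A a * vnorm X f"
        unfolding X.vnorm_smult[OF f] by (intro mult_right_mono dual_norm_bound \<phi>_dual a nX f)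
    qed
  next
    show "\<exists>K. \<forall>a\<in>carrier A. \<forall>f\<in>carrier X. vnorm X (twisted_translate u f a) \<le> K * vnorm A a * vnorm X f"
    proof (intro exI[of _ "1 + vnorm A u * vnorm (dual A) \<phi>"] ballI)
      fix a f assume a: "a \<in> carrier A" and f: "f \<in> carrier X"
      have "vnorm (dual A) (twisted_translate u f a) \<le> (1 + vnorm A u * vnorm (dual A) \<phi>) *
          vnorm (dual A) (\<lambda>x\<in>carrier A. f (a \<otimes> x))"
        unfolding twisted_translate_def
        using f by (intro annihilator_proj_norm u left_translate_closed a) simp
      also have "\<dots> \<le> (1 + vnorm A u * vnorm (dual A) \<phi>) * (vnorm (dual A) f * vnorm A a)"
        using f by (intro mult_left_mono left_translate_norm a add_nonneg_nonneg mult_nonneg_nonneg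
            dual_norm_nonneg vnorm_nonneg u \<phi>_dual) auto
      finally show "vnorm X (twisted_translate u f a)
          \<le> (1 + vnorm A u * vnorm (dual A) \<phi>) * vnorm A a * vnorm X f"
        by (simp add: mult_ac)
    qed
  qed
qed

text \<open>
  The functional \<open>n\<close> of evaluation at \<open>u\<close> satisfies \<open>n \<phi> = 1\<close> but is not invariant; its defect
  \<open>a n - \<phi> a n\<close> annihilates \<open>\<phi>\<close>, so as a function of \<open>a\<close> it is a derivation into the dual of the
  hyperplane, where it becomes \<open>f \<mapsto> f (a u)\<close>. Writing it as the defect of some \<open>\<psi>\<close> that also annihilates \<open>\<phi>\<close> and
  subtracting \<open>\<psi>\<close> from \<open>n\<close> repairs the invariance without changing the value at \<open>\<phi>\<close>.
\<close>

lemma left_amenable_imp_character_amenable: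
  assumes banach: "cbanach_space (dual A)" and u: "u \<in> carrier A" and \<phi>u: "\<phi> u = 1"
    and inner: "\<And>(X :: ('a \<Rightarrow> complex) normed) lact ract D.
      \<lbrakk>banach_bimodule A X lact ract; \<And>a x. \<lbrakk>a \<in> carrier A; x \<in> carrier X\<rbrakk> \<Longrightarrow> lact a x = \<phi> a \<odot>\<^bsub>X\<^esub> x;
       continuous_derivation A X lact ract D\<rbrakk> \<Longrightarrow> inner_derivation A X lact ract D"
  shows "character_amenable A \<phi>"
proof -
  define X where "X = (dual A)\<lparr>carrier := {f \<in> carrier (dual A). f u = 0}\<rparr>"
  define lact where "lact = (\<lambda>a f. \<phi> a \<odot>\<^bsub>X\<^esub> f)"
  define D where "D = (\<lambda>a. \<lambda>f\<in>carrier X. f (a \<otimes> u))"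
  interpret X: banach_bimodule A X lact "twisted_translate u"
    unfolding lact_def X_def by (rule twisted_bimodule[OF banach u \<phi>u])
  interpret DX: cnormed_space "dual X" by (rule X.X.cnormed_space_dual)
  interpret DA: cnormed_space "dual A" by (rule cnormed_space_dual)
  have car [simp]: "carrier X = {f \<in> carrier (dual A). f u = 0}"
    and ops [simp]: "f \<oplus>\<^bsub>X\<^esub> g = (\<lambda>x\<in>carrier A. f x + g x)" "c \<odot>\<^bsub>X\<^esub> f = (\<lambda>x\<in>carrier A. c * f x)"
      "vnorm X = vnorm (dual A)" for f g c
    by (simp_all add: X_def)
  have D_bound: "cmod (f (a \<otimes> u)) \<le> (vnorm A u * vnorm A a) * vnorm X f"
    if "a \<in> carrier A" "f \<in> carrier X" for a f
    using translate_bound[of f a u] that u by (simp add: mult_ac)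
  have D_closed: "D a \<in> carrier (dual X)" if a: "a \<in> carrier A" for a
    unfolding D_def
    by (rule X.X.dualI[OF _ _ D_bound[OF a]]) (use a u in \<open>auto simp: mult_closed\<close>)
  have lact_car: "lact a f \<in> carrier X" if "a \<in> carrier A" "f \<in> carrier X" for a f
    by (rule X.lact_closed[OF that])
  have tt_car: "twisted_translate u f a \<in> carrier X" if "a \<in> carrier A" "f \<in> carrier X" for a f
    by (rule X.ract_closed[OF that])
  have D_add: "D (a \<oplus> b) = D a \<oplus>\<^bsub>dual X\<^esub> D b" if "a \<in> carrier A" "b \<in> carrier A" for a b
    using that u by (auto simp: D_def fun_eq_iff mult_l_distr mult_closed dualD)
  have D_smult: "D (c \<odot> a) = c \<odot>\<^bsub>dual X\<^esub> D a" if "a \<in> carrier A" for a c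
    using that u by (auto simp: D_def fun_eq_iff mult_smult_l mult_closed dualD)
  have "continuous_derivation A X lact (twisted_translate u) D"
    unfolding continuous_derivation_def
  proof (intro conjI ballI allI)
    show "D \<in> carrier A \<rightarrow> carrier (dual X)" using D_closed by blast
    show "continuous_map (mtopology_of (norm_metric A)) (mtopology_of (norm_metric (dual X))) D"
    proof (subst continuous_map_linear_iff_bounded)
      show "\<exists>K. \<forall>a\<in>carrier A. vnorm (dual X) (D a) \<le> K * vnorm A a"
      proof (intro exI ballI)
        fix a assume a: "a \<in> carrier A"
        show "vnorm (dual X) (D a) \<le> vnorm A u * vnorm A a"
          by (rule X.X.dual_norm_le)
            (use a u D_bound[OF a] in \<open>auto simp: D_def vnorm_nonneg simp del: ops\<close>)
      qed
    qed (use D_closed D_add D_smult cnormed_space_axioms DX.cnormed_space_axioms in auto)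
  next
    fix a b assume ab: "a \<in> carrier A" "b \<in> carrier A"
    show "D (a \<otimes> b) = dual_lact X (twisted_translate u) a (D b) \<oplus>\<^bsub>dual X\<^esub> dual_ract X lact (D a) b"
    proof (rule ext)
      fix f
      show "D (a \<otimes> b) f
        = (dual_lact X (twisted_translate u) a (D b) \<oplus>\<^bsub>dual X\<^esub> dual_ract X lact (D a) b) f"
      proof (cases "f \<in> carrier X")
        case True
        have "D b (twisted_translate u f a) = f (a \<otimes> (b \<otimes> u)) - f (a \<otimes> u) * \<phi> b"
          using ab u \<phi>u tt_car[OF ab(1) True]
          by (simp add: D_def twisted_translate_eq mult_closed \<phi>_mult del: car)
        moreover have "D a (lact b f) = \<phi> b * f (a \<otimes> u)"
          using ab u lact_car[OF ab(2) True] by (simp add: D_def lact_def mult_closed del: car)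
        moreover have "D (a \<otimes> b) f = f (a \<otimes> (b \<otimes> u))"
          using ab u True by (simp add: D_def mult_assoc del: car)
        ultimately show ?thesis
          using True by (simp add: dual_lact_def dual_ract_def mult.commute del: car)
      qed (simp add: D_def del: car)
    qed
  qed (use D_add D_smult in auto)
  moreover have "lact a x = \<phi> a \<odot>\<^bsub>X\<^esub> x" for a x by (simp add: lact_def)
  ultimately have "inner_derivation A X lact (twisted_translate u) D"
    using inner X.banach_bimodule_axioms by blast
  then obtain \<psi> where \<psi>: "\<psi> \<in> carrier (dual X)"
    and D_eq: "\<And>a f. \<lbrakk>a \<in> carrier A; f \<in> carrier X\<rbrakk> \<Longrightarrow>
      D a f = \<psi> (twisted_translate u f a) - \<psi> (lact a f)"
    using X.inner_derivation_iff[of D] D_closed by blast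
  define p where "p = annihilator_proj u"
  have p_closed: "p f \<in> carrier X" if f: "f \<in> carrier (dual A)" for f
    using annihilator_proj_closed[OF u f] u \<phi>u by (simp add: p_def annihilator_proj_def)
  have p_norm: "vnorm X (p f) \<le> (1 + vnorm A u * vnorm (dual A) \<phi>) * vnorm (dual A) f"
    if "f \<in> carrier (dual A)" for f
    using annihilator_proj_norm[OF u that] by (simp add: p_def)
  \<comment> \<open>Composing \<open>\<psi>\<close> with the projection extends it to the whole dual, with value 0 at \<open>\<phi>\<close>.\<close>
  define m where "m = (\<lambda>f\<in>carrier (dual A). f u - \<psi> (p f))"
  have "m \<in> carrier (dual (dual A))"
    unfolding m_def
  proof (rule DA.dualI)
    fix f g assume fg: "f \<in> carrier (dual A)" "g \<in> carrier (dual A)"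
    have "p (f \<oplus>\<^bsub>dual A\<^esub> g) = p f \<oplus>\<^bsub>X\<^esub> p g"
      using u by (auto simp: p_def annihilator_proj_def fun_eq_iff algebra_simps)
    then show "(f \<oplus>\<^bsub>dual A\<^esub> g) u - \<psi> (p (f \<oplus>\<^bsub>dual A\<^esub> g)) = (f u - \<psi> (p f)) + (g u - \<psi> (p g))"
      using dualD(1)[OF \<psi> p_closed[OF fg(1)] p_closed[OF fg(2)]] u by (simp del: ops)
  next
    fix c f assume f: "f \<in> carrier (dual A)"
    have "p (c \<odot>\<^bsub>dual A\<^esub> f) = c \<odot>\<^bsub>X\<^esub> p f"
      using u by (auto simp: p_def annihilator_proj_def fun_eq_iff algebra_simps)
    then show "(c \<odot>\<^bsub>dual A\<^esub> f) u - \<psi> (p (c \<odot>\<^bsub>dual A\<^esub> f)) = c * (f u - \<psi> (p f))"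
      using dualD(2)[OF \<psi> p_closed[OF f]] u by (simp add: algebra_simps del: ops)
  next
    fix f assume f: "f \<in> carrier (dual A)"
    have "cmod (f u - \<psi> (p f)) \<le> cmod (f u) + cmod (\<psi> (p f))" by (rule norm_triangle_ineq4)
    also have "\<dots> \<le> vnorm (dual A) f * vnorm A u + vnorm (dual X) \<psi> * vnorm X (p f)"
      by (intro add_mono dual_norm_bound X.X.dual_norm_bound \<psi> f u p_closed)
    also have "\<dots> \<le> vnorm (dual A) f * vnorm A u
        + vnorm (dual X) \<psi> * ((1 + vnorm A u * vnorm (dual A) \<phi>) * vnorm (dual A) f)"
      by (intro add_left_mono mult_left_mono p_norm f X.X.dual_norm_nonneg \<psi>)
    finally show "cmod (f u - \<psi> (p f))
        \<le> (vnorm A u + vnorm (dual X) \<psi> * (1 + vnorm A u * vnorm (dual A) \<phi>)) * vnorm (dual A) f"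
      by (simp add: algebra_simps)
  qed
  moreover have "m \<phi> = 1"
  proof -
    have "p \<phi> = \<zero>\<^bsub>X\<^esub>" using \<phi>u by (auto simp: p_def annihilator_proj_def X_def fun_eq_iff)
    then have "\<psi> (p \<phi>) = 0"
      using X.X.functional_zero \<psi> by (simp add: dual_carrier_iff)
    then show ?thesis using \<phi>_dual \<phi>u by (simp add: m_def)
  qed
  moreover have "m (\<lambda>x\<in>carrier A. f (a \<otimes> x)) = \<phi> a * m f"
    if a: "a \<in> carrier A" and f: "f \<in> carrier (dual A)" for a f
  proof -
    have "p (\<lambda>x\<in>carrier A. f (a \<otimes> x)) = twisted_translate u (p f) a"
      using a u by (auto simp: p_def annihilator_proj_def twisted_translate_eq fun_eq_iff mult_closed \<phi>_mult \<phi>u algebra_simps)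
    moreover have "f (a \<otimes> u) - f u * \<phi> a = \<psi> (twisted_translate u (p f) a) - \<phi> a * \<psi> (p f)"
      using D_eq[OF a p_closed[OF f]] a u p_closed[OF f] dualD(2)[OF \<psi> p_closed[OF f]] \<phi>u
      by (simp add: D_def lact_def p_def annihilator_proj_def mult_closed \<phi>_mult del: car ops)
    ultimately show ?thesis
      using left_translate_closed[OF f a] f u by (simp add: m_def algebra_simps)
  qed
  ultimately show ?thesis unfolding character_amenable_iff by blast
qed

end

section \<open>Transfer between the algebra and a left ideal\<close>

locale left_ideal_of_character_algebra = character_algebra +
  fixes J :: "'a set" and u :: 'a
  assumes submodule: "submodule J complex_field A"
    and ideal: "\<lbrakk>a \<in> carrier A; j \<in> J\<rbrakk> \<Longrightarrow> a \<otimes> j \<in> J"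
    and u: "u \<in> J" and \<phi>u: "\<phi> u = 1"
begin

abbreviation B where "B \<equiv> A\<lparr>carrier := J\<rparr>"

lemma J_subset: "j \<in> J \<Longrightarrow> j \<in> carrier A"
  using submoduleE(1)[OF submodule] by blast

lemma cnormed_space_B: "cnormed_space B"
  by (rule cnormed_space_subspace[OF submodule])

sublocale B: cnormed_space B
  by (rule cnormed_space_B)

lemma ideal_translate_bound:
  assumes f: "f \<in> carrier (dual B)" and a: "a \<in> carrier A" and j: "j \<in> J"
  shows "cmod (f (a \<otimes> j)) \<le> vnorm (dual B) f * (vnorm A a * vnorm A j)"
proof -
  have "cmod (f (a \<otimes> j)) \<le> vnorm (dual B) f * vnorm A (a \<otimes> j)"
    using B.dual_norm_bound[OF f, of "a \<otimes> j"] ideal[OF a j] by simp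
  also have "\<dots> \<le> vnorm (dual B) f * (vnorm A a * vnorm A j)"
    by (intro mult_left_mono vnorm_mult B.dual_norm_nonneg f a J_subset j)
  finally show ?thesis .
qed

lemma ideal_translate_closed:
  assumes f: "f \<in> carrier (dual B)" and a: "a \<in> carrier A"
  shows "(\<lambda>j\<in>J. f (a \<otimes> j)) \<in> carrier (dual B)"
proof -
  have "cmod (f (a \<otimes> j)) \<le> (vnorm (dual B) f * vnorm A a) * vnorm B j" if "j \<in> carrier B" for j
    using ideal_translate_bound[OF f a] that by (simp add: mult.assoc)
  then have "restrict (\<lambda>j. f (a \<otimes> j)) (carrier B) \<in> carrier (dual B)"
    using dualD(1,2)[OF f] a
    by (intro B.dualI) (auto simp: mult_r_distr mult_smult_r J_subset ideal)
  then show ?thesis by simp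
qed

lemma restrict_\<phi>_dual: "restrict \<phi> J \<in> carrier (dual B)"
proof -
  have "restrict \<phi> (carrier B) \<in> carrier (dual B)"
    using dual_norm_bound[OF \<phi>_dual] submoduleE(4,5)[OF submodule]
    by (intro B.dualI[where K = "vnorm (dual A) \<phi>"]) (auto simp: J_subset \<phi>_add \<phi>_smult)
  then show ?thesis by simp
qed

text \<open>
  Right multiplication by \<open>u\<close> maps \<open>A\<close> into the left ideal \<open>J\<close>, commutes with left
  multiplications, and preserves \<open>\<phi>\<close> since \<open>\<phi> u = 1\<close>. Pulling functionals on \<open>J\<close> back along it
  avoids any extension of functionals from \<open>J\<close> to \<open>A\<close>.
\<close>

lemma character_amenable_imp_ideal:
  assumes "character_amenable A \<phi>"
  shows "character_amenable B (restrict \<phi> J)"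
proof -
  interpret DA: cnormed_space "dual A" by (rule cnormed_space_dual)
  interpret DB: cnormed_space "dual B" by (rule B.cnormed_space_dual)
  obtain m where m: "m \<in> carrier (dual (dual A))" "m \<phi> = 1"
    and inv: "\<And>a f. \<lbrakk>a \<in> carrier A; f \<in> carrier (dual A)\<rbrakk> \<Longrightarrow>
      m (\<lambda>x\<in>carrier A. f (a \<otimes> x)) = \<phi> a * m f"
    using assms unfolding character_amenable_iff by blast
  have uA: "u \<in> carrier A" by (rule J_subset[OF u])
  define R where "R f = (\<lambda>a\<in>carrier A. f (a \<otimes> u))" for f :: "'a \<Rightarrow> complex"
  have R_bound: "cmod (f (a \<otimes> u)) \<le> (vnorm A u * vnorm (dual B) f) * vnorm A a"
    if "f \<in> carrier (dual B)" "a \<in> carrier A" for f a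
    using ideal_translate_bound[OF that u] by (simp add: mult_ac)
  have R_closed: "R f \<in> carrier (dual A)" if f: "f \<in> carrier (dual B)" for f
    unfolding R_def
    by (rule dualI[OF _ _ R_bound[OF f]])
      (use dualD(1,2)[OF f] uA u in \<open>auto simp: mult_l_distr mult_smult_l ideal\<close>)
  have R_norm: "vnorm (dual A) (R f) \<le> vnorm A u * vnorm (dual B) f" if f: "f \<in> carrier (dual B)" for f
    using R_bound[OF f] by (intro dual_norm_le mult_nonneg_nonneg vnorm_nonneg uA B.dual_norm_nonneg f)
      (auto simp: R_def)
  define mJ where "mJ = (\<lambda>f\<in>carrier (dual B). m (R f))"
  have "mJ \<in> carrier (dual (dual B))"
    unfolding mJ_def
  proof (rule DB.dualI)
    fix f g assume fg: "f \<in> carrier (dual B)" "g \<in> carrier (dual B)"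
    have "R (f \<oplus>\<^bsub>dual B\<^esub> g) = R f \<oplus>\<^bsub>dual A\<^esub> R g" using ideal u by (auto simp: R_def fun_eq_iff)
    then show "m (R (f \<oplus>\<^bsub>dual B\<^esub> g)) = m (R f) + m (R g)"
      using dualD(1)[OF m(1) R_closed[OF fg(1)] R_closed[OF fg(2)]] by simp
  next
    fix c f assume f: "f \<in> carrier (dual B)"
    have "R (c \<odot>\<^bsub>dual B\<^esub> f) = c \<odot>\<^bsub>dual A\<^esub> R f" using ideal u by (auto simp: R_def fun_eq_iff)
    then show "m (R (c \<odot>\<^bsub>dual B\<^esub> f)) = c * m (R f)"
      using dualD(2)[OF m(1) R_closed[OF f]] by simp
  next
    fix f assume f: "f \<in> carrier (dual B)"
    have "cmod (m (R f)) \<le> vnorm (dual (dual A)) m * vnorm (dual A) (R f)"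
      by (intro DA.dual_norm_bound m R_closed f)
    also have "\<dots> \<le> vnorm (dual (dual A)) m * (vnorm A u * vnorm (dual B) f)"
      by (intro mult_left_mono R_norm f DA.dual_norm_nonneg m)
    finally show "cmod (m (R f)) \<le> (vnorm (dual (dual A)) m * vnorm A u) * vnorm (dual B) f"
      by (simp add: mult.assoc)
  qed
  moreover have "mJ (restrict \<phi> J) = 1"
  proof -
    have "R (restrict \<phi> J) = \<phi>"
      using dualD(3)[OF \<phi>_dual] ideal u uA
      by (auto simp: R_def fun_eq_iff \<phi>_mult \<phi>u extensional_def)
    then show ?thesis using restrict_\<phi>_dual m by (simp add: mJ_def)
  qed
  moreover have "mJ (\<lambda>x\<in>carrier B. f (b \<otimes>\<^bsub>B\<^esub> x)) = restrict \<phi> J b * mJ f"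
    if b: "b \<in> carrier B" and f: "f \<in> carrier (dual B)" for b f
  proof -
    have bA: "b \<in> carrier A" using b by (simp add: J_subset)
    have "R (\<lambda>j\<in>J. f (b \<otimes> j)) = (\<lambda>x\<in>carrier A. R f (b \<otimes> x))"
      using bA uA u ideal by (auto simp: R_def fun_eq_iff mult_closed mult_assoc)
    then show ?thesis
      using inv[OF bA R_closed[OF f]] ideal_translate_closed[OF f bA] f b by (simp add: mJ_def)
  qed
  ultimately show ?thesis unfolding character_amenable_iff by blast
qed

text \<open>
  Invariance under \<open>u\<close> with \<open>\<phi> u = 1\<close> allows a factor \<open>u\<close> to be inserted, and then \<open>a\<close> acts through
  \<open>a u\<close>, which belongs to \<open>J\<close>.
\<close>

lemma ideal_invariance_extends:
  assumes inv: "\<And>b f. \<lbrakk>b \<in> J; f \<in> carrier (dual B)\<rbrakk> \<Longrightarrow> m (\<lambda>j\<in>J. f (b \<otimes> j)) = \<phi> b * m f"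
    and a: "a \<in> carrier A" and f: "f \<in> carrier (dual B)"
  shows "m (\<lambda>j\<in>J. f (a \<otimes> j)) = \<phi> a * m f"
proof -
  have uA: "u \<in> carrier A" by (rule J_subset[OF u])
  let ?g = "\<lambda>j\<in>J. f (a \<otimes> j)"
  have "m ?g = m (\<lambda>j\<in>J. ?g (u \<otimes> j))"
    using inv[OF u ideal_translate_closed[OF f a]] \<phi>u by simp
  also have "(\<lambda>j\<in>J. ?g (u \<otimes> j)) = (\<lambda>j\<in>J. f ((a \<otimes> u) \<otimes> j))"
    using a uA ideal by (auto simp: fun_eq_iff mult_assoc J_subset)
  also have "m \<dots> = \<phi> a * m f"
    using inv[OF ideal[OF a u] f] a uA by (simp add: \<phi>_mult \<phi>u)
  finally show ?thesis .
qed

text \<open>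
  The functional on \<open>X\<close> implementing \<open>D\<close> is minus the average of \<open>D j x\<close> over \<open>j\<close> in \<open>J\<close>.
  Invariance under all of \<open>A\<close> is essential: \<open>D\<close> has to be recovered at every \<open>a\<close> in \<open>A\<close> although
  the average only sees \<open>J\<close>.
\<close>

lemma character_amenable_ideal_imp_inner:
  assumes amen: "character_amenable B (restrict \<phi> J)"
    and bimod: "banach_bimodule A X lact ract"
    and lact: "\<And>a x. \<lbrakk>a \<in> carrier A; x \<in> carrier X\<rbrakk> \<Longrightarrow> lact a x = \<phi> a \<odot>\<^bsub>X\<^esub> x"
    and D: "continuous_derivation A X lact ract D"
  shows "inner_derivation A X lact ract D"
proof -
  interpret X: banach_bimodule A X lact ract by (rule bimod)
  interpret DX: cnormed_space "dual X" by (rule X.X.cnormed_space_dual)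
  interpret DB: cnormed_space "dual B" by (rule B.cnormed_space_dual)
  obtain m where m: "m \<in> carrier (dual (dual B))" "m (restrict \<phi> J) = 1"
    and inv_J: "\<And>b f. \<lbrakk>b \<in> J; f \<in> carrier (dual B)\<rbrakk> \<Longrightarrow> m (\<lambda>j\<in>J. f (b \<otimes> j)) = \<phi> b * m f"
    using amen unfolding character_amenable_iff by auto
  have inv: "\<And>a f. \<lbrakk>a \<in> carrier A; f \<in> carrier (dual B)\<rbrakk> \<Longrightarrow> m (\<lambda>j\<in>J. f (a \<otimes> j)) = \<phi> a * m f"
    by (rule ideal_invariance_extends[OF inv_J])
  have D_fun: "D \<in> carrier A \<rightarrow> carrier (dual X)"
    and D_add: "\<And>a b. \<lbrakk>a \<in> carrier A; b \<in> carrier A\<rbrakk> \<Longrightarrow> D (a \<oplus> b) = D a \<oplus>\<^bsub>dual X\<^esub> D b"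
    and D_smult: "\<And>c a. a \<in> carrier A \<Longrightarrow> D (c \<odot> a) = c \<odot>\<^bsub>dual X\<^esub> D a"
    and D_mult: "\<And>a b. \<lbrakk>a \<in> carrier A; b \<in> carrier A\<rbrakk> \<Longrightarrow>
        D (a \<otimes> b) = dual_lact X ract a (D b) \<oplus>\<^bsub>dual X\<^esub> dual_ract X lact (D a) b"
    and cont: "continuous_map (mtopology_of (norm_metric A)) (mtopology_of (norm_metric (dual X))) D"
    using D unfolding continuous_derivation_def by blast+
  have D_closed: "D a \<in> carrier (dual X)" if "a \<in> carrier A" for a using D_fun that by blast
  obtain K where K: "\<And>a. a \<in> carrier A \<Longrightarrow> vnorm (dual X) (D a) \<le> K * vnorm A a"
    using continuous_map_linear_iff_bounded[OF cnormed_space_axioms DX.cnormed_space_axioms D_fun D_add D_smult]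
      cont by blast
  have D_bound: "cmod (D j x) \<le> (\<bar>K\<bar> * vnorm X x) * vnorm A j" if "j \<in> carrier A" "x \<in> carrier X" for j x
  proof -
    have "cmod (D j x) \<le> vnorm (dual X) (D j) * vnorm X x"
      by (intro X.X.dual_norm_bound D_closed that)
    also have "\<dots> \<le> (\<bar>K\<bar> * vnorm A j) * vnorm X x"
      using K[OF that(1)] vnorm_nonneg[OF that(1)]
      by (intro mult_right_mono X.X.vnorm_nonneg that)
        (meson abs_ge_self mult_right_mono order_trans)
    finally show ?thesis by (simp add: mult_ac)
  qed
  have Leibniz: "D (a \<otimes> b) x = D b (ract x a) + \<phi> b * D a x"
    if "a \<in> carrier A" "b \<in> carrier A" "x \<in> carrier X" for a b x
    using that dualD(2)[OF D_closed] by (simp add: D_mult dual_lact_def dual_ract_def lact)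
  define g where "g x = (\<lambda>j\<in>J. D j x)" for x
  have g_closed: "g x \<in> carrier (dual B)" if x: "x \<in> carrier X" for x
  proof -
    have "restrict (\<lambda>j. D j x) (carrier B) \<in> carrier (dual B)"
      by (rule B.dualI[where K = "\<bar>K\<bar> * vnorm X x"])
        (use x D_bound in \<open>auto simp: J_subset D_add D_smult\<close>)
    then show ?thesis by (simp add: g_def)
  qed
  have g_norm: "vnorm (dual B) (g x) \<le> \<bar>K\<bar> * vnorm X x" if x: "x \<in> carrier X" for x
    by (rule B.dual_norm_le) (use x D_bound X.X.vnorm_nonneg in \<open>auto simp: g_def J_subset\<close>)
  define F where "F = (\<lambda>x\<in>carrier X. - m (g x))"
  have F: "F \<in> carrier (dual X)"
    unfolding F_def
  proof (rule X.X.dualI)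
    fix x y assume xy: "x \<in> carrier X" "y \<in> carrier X"
    have "g (x \<oplus>\<^bsub>X\<^esub> y) = g x \<oplus>\<^bsub>dual B\<^esub> g y"
      using xy dualD(1)[OF D_closed] by (auto simp: g_def fun_eq_iff J_subset)
    then show "- m (g (x \<oplus>\<^bsub>X\<^esub> y)) = - m (g x) + - m (g y)"
      using dualD(1)[OF m(1) g_closed[OF xy(1)] g_closed[OF xy(2)]] by simp
  next
    fix c x assume x: "x \<in> carrier X"
    have "g (c \<odot>\<^bsub>X\<^esub> x) = c \<odot>\<^bsub>dual B\<^esub> g x"
      using x dualD(2)[OF D_closed] by (auto simp: g_def fun_eq_iff J_subset)
    then show "- m (g (c \<odot>\<^bsub>X\<^esub> x)) = c * - m (g x)"
      using dualD(2)[OF m(1) g_closed[OF x]] by simp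
  next
    fix x assume x: "x \<in> carrier X"
    have "cmod (- m (g x)) \<le> vnorm (dual (dual B)) m * vnorm (dual B) (g x)"
      using DB.dual_norm_bound[OF m(1) g_closed[OF x]] by simp
    also have "\<dots> \<le> vnorm (dual (dual B)) m * (\<bar>K\<bar> * vnorm X x)"
      by (intro mult_left_mono g_norm x DB.dual_norm_nonneg m)
    finally show "cmod (- m (g x)) \<le> (vnorm (dual (dual B)) m * \<bar>K\<bar>) * vnorm X x"
      by (simp add: mult.assoc)
  qed
  have "D a x = F (ract x a) - F (lact a x)" if a: "a \<in> carrier A" and x: "x \<in> carrier X" for a x
  proof -
    have xa: "ract x a \<in> carrier X" by (rule X.ract_closed[OF a x])
    \<comment> \<open>The Leibniz rule for \<open>D (a \<otimes> j)\<close>, read as an identity of functionals of \<open>j\<close>.\<close>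
    have "(\<lambda>j\<in>J. g x (a \<otimes> j)) = g (ract x a) \<oplus>\<^bsub>dual B\<^esub> (D a x \<odot>\<^bsub>dual B\<^esub> restrict \<phi> J)"
      using a x by (auto simp: g_def fun_eq_iff ideal J_subset Leibniz)
    moreover have "D a x \<odot>\<^bsub>dual B\<^esub> restrict \<phi> J \<in> carrier (dual B)"
      by (rule DB.scalar_closed[OF restrict_\<phi>_dual])
    ultimately have "\<phi> a * m (g x) = m (g (ract x a)) + D a x"
      using inv[OF a g_closed[OF x]] dualD(1)[OF m(1) g_closed[OF xa]]
        dualD(2)[OF m(1) restrict_\<phi>_dual] m(2) by (metis mult.right_neutral)
    moreover have "F (lact a x) = \<phi> a * F x"
      using dualD(2)[OF F x] by (simp add: lact a x)
    moreover have "F x = - m (g x)" "F (ract x a) = - m (g (ract x a))"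
      using x xa by (simp_all add: F_def)
    ultimately show ?thesis by simp
  qed
  then show ?thesis unfolding X.inner_derivation_iff[OF D_fun] using F by blast
qed

end

theorem theorem5p3:
  fixes A :: "'a normed" and M :: "('a \<Rightarrow> complex) star_normed"
  assumes "F_algebra A M"
  shows
    "(left_amenable TYPE('a \<Rightarrow> complex) A M \<longrightarrow>
        (\<forall>J. closed_left_ideal J A \<and> restrict \<one>\<^bsub>M\<^esub> J \<noteq> \<zero>\<^bsub>dual (A\<lparr>carrier := J\<rparr>)\<^esub> \<longrightarrow>
           character_amenable (A\<lparr>carrier := J\<rparr>) (restrict \<one>\<^bsub>M\<^esub> J))) \<and>
     ((\<exists>J. closed_left_ideal J A \<and> restrict \<one>\<^bsub>M\<^esub> J \<noteq> \<zero>\<^bsub>dual (A\<lparr>carrier := J\<rparr>)\<^esub> \<and>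
           character_amenable (A\<lparr>carrier := J\<rparr>) (restrict \<one>\<^bsub>M\<^esub> J)) \<longrightarrow>
        left_amenable TYPE('x) A M)"
proof -
  interpret character_algebra A "\<one>\<^bsub>M\<^esub>"
    using assms by (simp add: F_algebra_def character_algebra_def character_algebra_axioms_def)
  have banach: "cbanach_space (dual A)"
    using assms by (intro wstar_predual_dual_banach[of M]) (simp add: F_algebra_def)
  have ideal: "\<exists>u. left_ideal_of_character_algebra A \<one>\<^bsub>M\<^esub> J u"
    if J: "closed_left_ideal J A" and nz: "restrict \<one>\<^bsub>M\<^esub> J \<noteq> \<zero>\<^bsub>dual (A\<lparr>carrier := J\<rparr>)\<^esub>" for J
  proof -
    have sub: "submodule J complex_field A" using J by (simp add: closed_left_ideal_def)
    obtain j where j: "j \<in> J" "\<one>\<^bsub>M\<^esub> j \<noteq> 0"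
      using nz restrict_ext[of J "\<one>\<^bsub>M\<^esub>" "\<lambda>_. 0"] by auto
    have jA: "j \<in> carrier A" using submoduleE(1)[OF sub] j by blast
    have "inverse (\<one>\<^bsub>M\<^esub> j) \<odot>\<^bsub>A\<^esub> j \<in> J" using submoduleE(4)[OF sub] j by simp
    moreover have "\<one>\<^bsub>M\<^esub> (inverse (\<one>\<^bsub>M\<^esub> j) \<odot>\<^bsub>A\<^esub> j) = 1" using j jA by (simp add: \<phi>_smult)
    ultimately have "left_ideal_of_character_algebra A \<one>\<^bsub>M\<^esub> J (inverse (\<one>\<^bsub>M\<^esub> j) \<odot>\<^bsub>A\<^esub> j)"
      using J j sub character_algebra_axioms
      by (intro left_ideal_of_character_algebra.intro
          left_ideal_of_character_algebra_axioms.intro) (auto simp only: closed_left_ideal_def)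
    then show ?thesis ..
  qed
  show ?thesis
  proof (intro conjI impI allI)
    fix J assume la: "left_amenable TYPE('a \<Rightarrow> complex) A M"
      and J: "closed_left_ideal J A \<and> restrict \<one>\<^bsub>M\<^esub> J \<noteq> \<zero>\<^bsub>dual (A\<lparr>carrier := J\<rparr>)\<^esub>"
    obtain u where "left_ideal_of_character_algebra A \<one>\<^bsub>M\<^esub> J u" using ideal J by blast
    then interpret left_ideal_of_character_algebra A "\<one>\<^bsub>M\<^esub>" J u .
    have "inner_derivation A X lact ract D"
      if "banach_bimodule A X lact ract"
        and "\<And>a x. \<lbrakk>a \<in> carrier A; x \<in> carrier X\<rbrakk> \<Longrightarrow> lact a x = \<one>\<^bsub>M\<^esub> a \<odot>\<^bsub>X\<^esub> x"
        and "continuous_derivation A X lact ract D"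
      for X :: "('a \<Rightarrow> complex) normed" and lact ract D
      using la[unfolded left_amenable_def, rule_format, of X lact ract D] that by simp
    then have "character_amenable A \<one>\<^bsub>M\<^esub>"
      by (rule left_amenable_imp_character_amenable[OF banach J_subset[OF u] \<phi>u])
    then show "character_amenable (A\<lparr>carrier := J\<rparr>) (restrict \<one>\<^bsub>M\<^esub> J)"
      by (rule character_amenable_imp_ideal)
  next
    assume "\<exists>J. closed_left_ideal J A \<and> restrict \<one>\<^bsub>M\<^esub> J \<noteq> \<zero>\<^bsub>dual (A\<lparr>carrier := J\<rparr>)\<^esub> \<and>
           character_amenable (A\<lparr>carrier := J\<rparr>) (restrict \<one>\<^bsub>M\<^esub> J)"
    then obtain J where J: "closed_left_ideal J A" "restrict \<one>\<^bsub>M\<^esub> J \<noteq> \<zero>\<^bsub>dual (A\<lparr>carrier := J\<rparr>)\<^esub>"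
      and amen: "character_amenable (A\<lparr>carrier := J\<rparr>) (restrict \<one>\<^bsub>M\<^esub> J)" by blast
    obtain u where "left_ideal_of_character_algebra A \<one>\<^bsub>M\<^esub> J u" using ideal J by blast
    then interpret left_ideal_of_character_algebra A "\<one>\<^bsub>M\<^esub>" J u .
    show "left_amenable TYPE('x) A M"
      unfolding left_amenable_def
    proof (intro allI impI, elim conjE)
      fix X :: "'x normed" and lact ract D
      assume "banach_bimodule A X lact ract"
        and "\<forall>a\<in>carrier A. \<forall>x\<in>carrier X. lact a x = \<one>\<^bsub>M\<^esub> a \<odot>\<^bsub>X\<^esub> x"
        and "continuous_derivation A X lact ract D"
      then show "inner_derivation A X lact ract D"
        by (intro character_amenable_ideal_imp_inner[OF amen]) simp_all
    qed
  qed
qed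

end
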